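(* Let $n\ge 1$, let $A$ be an $n\times n$ matrix with real entries, and let $T>0$ be a real number with $\Vert A\Vert_2\le T$. Then $$|\mathrm{perm}(A)|\le T^{n}(n+6)\exp\left[\frac{-\sqrt{n(1-h_\infty(A)/T)}}{400}\right].$$
   Context: The permanent is $\mathrm{perm}(A)=\sum_{\sigma\in S_n}\prod_{i=1}^n a_{i,\sigma(i)}$. $\Vert A\Vert_2$ is the operator 2-norm of $A$. For a matrix $A$ with rows $r_1,\dots,r_n$, $h_\infty(A)=\frac1n\sum_{i=1}^n\Vert r_i\Vert_\infty$, where $\Vert r_i\Vert_\infty$ is the maximum absolute value of an entry of $r_i$. *)

theory Defs
  imports "HOL-Analysis.Analysis"
begin

definition perm :: "'a::comm_ring_1^'n^'n \<Rightarrow> 'a" where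
  "perm A = (\<Sum>\<sigma> | \<sigma> permutes (UNIV :: 'n set). \<Prod>i\<in>UNIV. A $ i $ \<sigma> i)"

definition h_inf :: "real^'n^'n \<Rightarrow> real" where
  "h_inf A = (1 / real CARD('n)) * (\<Sum>i\<in>UNIV. infnorm (row i A))"

end

theory Submission
  imports Defs
begin

text \<open>After scaling, \<open>T = 1\<close>. By a version of Glynn's formula, \<open>perm A\<close> is the average of
  \<open>\<Prod>j. cnj (x j)\<close> times \<open>\<Prod>i. (A x) i\<close> over vectors \<open>x\<close> of \<open>m\<close>-th roots of unity, and
  \<open>t \<le> exp (t - 1)\<close> bounds the modulus of the integrand by \<open>exp (- G x / 2)\<close>, where the deficit
  \<open>G x = 2 * (\<Sum>i. 1 - \<bar>(A x) i\<bar>)\<close> is nonnegative.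

  Writing \<open>G x\<close> as the minimum of \<open>\<bar>x\<bar>\<^sup>2 + \<bar>u\<bar>\<^sup>2 - 2 Re \<langle>A x, u\<rangle>\<close> over unimodular \<open>u\<close>, and
  using that \<open>A\<^sup>T\<close> is a contraction, the discrete gradient of \<open>sqrt (G + 1)\<close> is bounded when \<open>m\<close> is
  large compared with \<open>n\<close>. The Poincare inequality on the product of cyclic groups, applied to
  \<open>exp (- l * sqrt (G + 1) / 2)\<close> for \<open>l\<close>, \<open>l / 2\<close>, \<open>l / 4\<close>, \<dots>, then gives exponential
  concentration of \<open>sqrt (G + 1)\<close> about its mean.

  The mean of \<open>G\<close> is at least \<open>n * (1 - h_inf A) / 96\<close>: split a row into two parts \<open>u\<close>, \<open>z\<close> of nearly
  equal Euclidean norm; turning the phase of \<open>u\<close> through multiples of a right angle makes the modulus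
  of \<open>z + u\<close> fluctuate, which keeps its mean away from \<open>1\<close>.\<close>

section \<open>Averages and a Poincare inequality\<close>

definition avg :: "'a set \<Rightarrow> ('a \<Rightarrow> real) \<Rightarrow> real" where
  "avg X f = (\<Sum>x\<in>X. f x) / real (card X)"

lemma avg_mono: "(\<And>x. x \<in> X \<Longrightarrow> f x \<le> g x) \<Longrightarrow> avg X f \<le> avg X g"
  unfolding avg_def by (intro divide_right_mono sum_mono) auto

lemma avg_cong: "(\<And>x. x \<in> X \<Longrightarrow> f x = g x) \<Longrightarrow> avg X f = avg X g"
  unfolding avg_def by (metis (mono_tags, lifting) sum.cong)

lemma avg_nonneg: "(\<And>x. x \<in> X \<Longrightarrow> 0 \<le> f x) \<Longrightarrow> 0 \<le> avg X f"
  unfolding avg_def by (intro divide_nonneg_nonneg sum_nonneg) auto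

lemma avg_add: "avg X (\<lambda>x. f x + g x) = avg X f + avg X g"
  by (simp add: avg_def sum.distrib add_divide_distrib)

lemma avg_diff: "avg X (\<lambda>x. f x - g x) = avg X f - avg X g"
  by (simp add: avg_def sum_subtractf diff_divide_distrib)

lemma avg_cmult: "avg X (\<lambda>x. c * f x) = c * avg X f"
  by (simp add: avg_def sum_distrib_left)

lemma avg_cdiv: "avg X (\<lambda>x. f x / c) = avg X f / c"
  by (simp add: avg_def flip: sum_divide_distrib)

lemma avg_sum: "avg X (\<lambda>x. \<Sum>i\<in>I. f i x) = (\<Sum>i\<in>I. avg X (f i))"
  unfolding avg_def by (subst sum.swap) (simp add: sum_divide_distrib)

lemma avg_const: "finite X \<Longrightarrow> X \<noteq> {} \<Longrightarrow> avg X (\<lambda>x. c) = c"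
  by (simp add: avg_def)

lemma avg_bij: "bij_betw T X X \<Longrightarrow> avg X (\<lambda>x. f (T x)) = avg X f"
  unfolding avg_def using sum.reindex_bij_betw by metis

lemma bij_betw_funpow:
  assumes "bij_betw T X X"
  shows "bij_betw (T ^^ d) X X"
proof (induction d)
  case 0
  then show ?case by (simp add: bij_betw_def)
next
  case (Suc d)
  show ?case using bij_betw_trans[OF Suc assms] by (simp add: comp_def)
qed

text \<open>Telescope the jump into \<open>d\<close> single steps and apply Cauchy-Schwarz; since
  \<open>T\<close> permutes \<open>X\<close>, every single step has the same mean square.\<close>

lemma avg_square_diff_funpow:
  assumes T: "bij_betw T X X"
  shows "avg X (\<lambda>x. (f ((T ^^ d) x) - f x)\<^sup>2) \<le> (real d)\<^sup>2 * avg X (\<lambda>x. (f (T x) - f x)\<^sup>2)"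
proof -
  let ?D = "\<lambda>x. f (T x) - f x"
  have "(f ((T ^^ d) x) - f x)\<^sup>2 \<le> real d * (\<Sum>k<d. (?D ((T ^^ k) x))\<^sup>2)" for x
  proof -
    have "f ((T ^^ d) x) - f x = (\<Sum>k<d. ?D ((T ^^ k) x))"
      using sum_lessThan_telescope[of "\<lambda>k. f ((T ^^ k) x)" d] by simp
    then show ?thesis
      using sum_squared_le_sum_of_squares[of "\<lambda>k. ?D ((T ^^ k) x)" "{..<d}"]
      by (simp add: mult.commute)
  qed
  then have "avg X (\<lambda>x. (f ((T ^^ d) x) - f x)\<^sup>2)
      \<le> avg X (\<lambda>x. real d * (\<Sum>k<d. (?D ((T ^^ k) x))\<^sup>2))"
    by (intro avg_mono)
  also have "\<dots> = real d * (\<Sum>k<d. avg X (\<lambda>x. (?D ((T ^^ k) x))\<^sup>2))"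
    by (simp only: avg_cmult avg_sum)
  also have "\<dots> = real d * (\<Sum>k<d. avg X (\<lambda>x. (?D x)\<^sup>2))"
    using avg_bij[OF bij_betw_funpow[OF T], of "\<lambda>x. (?D x)\<^sup>2"] by simp
  also have "\<dots> = (real d)\<^sup>2 * avg X (\<lambda>x. (?D x)\<^sup>2)"
    by (simp add: power2_eq_square)
  finally show ?thesis .
qed

lemma sum_squares_le_cube: "(\<Sum>d<m. (real d)\<^sup>2) \<le> real m ^ 3 / 3"
  by (induction m) (auto simp: power2_eq_square power3_eq_cube field_simps)

text \<open>When \<open>T\<close> permutes \<open>X\<close> with \<open>T ^^ m\<close> the identity
  there, this is the conditional expectation onto \<open>T\<close>-invariant functions.\<close>

definition cyc_avg :: "('a \<Rightarrow> 'a) \<Rightarrow> nat \<Rightarrow> ('a \<Rightarrow> real) \<Rightarrow> 'a \<Rightarrow> real" where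
  "cyc_avg T m f x = (\<Sum>d<m. f ((T ^^ d) x)) / real m"

lemma cyc_avg_invariant:
  assumes "(T ^^ m) x = x"
  shows "cyc_avg T m f (T x) = cyc_avg T m f x"
proof -
  have "(\<Sum>d<m. f ((T ^^ d) (T x))) = (\<Sum>d<m. f ((T ^^ Suc d) x))"
    by (simp add: funpow_swap1)
  also have "\<dots> = (\<Sum>d<m. f ((T ^^ d) x))"
    using sum.lessThan_Suc_shift[of "\<lambda>d. f ((T ^^ d) x)" m]
      sum.lessThan_Suc[of "\<lambda>d. f ((T ^^ d) x)" m] assms by simp
  finally show ?thesis by (simp add: cyc_avg_def)
qed

lemma square_mean_le:
  fixes a :: "nat \<Rightarrow> real"
  shows "((\<Sum>d<m. a d) / real m)\<^sup>2 \<le> (\<Sum>d<m. (a d)\<^sup>2) / real m"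
proof (cases "m = 0")
  case False
  have "(\<Sum>d<m. a d)\<^sup>2 \<le> (\<Sum>d<m. (a d)\<^sup>2) * real m"
    using sum_squared_le_sum_of_squares[of a "{..<m}"] by simp
  then show ?thesis
    using False by (simp add: power_divide power2_eq_square field_simps)
qed simp

lemma avg_cyc_avg:
  assumes T: "bij_betw T X X" and m: "m > 0"
  shows "avg X (cyc_avg T m f) = avg X f"
proof -
  have "avg X (cyc_avg T m f) = (\<Sum>d<m. avg X (\<lambda>x. f ((T ^^ d) x))) / real m"
    unfolding cyc_avg_def by (simp only: avg_cdiv avg_sum)
  also have "\<dots> = avg X f"
    using avg_bij[OF bij_betw_funpow[OF T], of f] m by simp
  finally show ?thesis .
qed

text \<open>The cyclic average is an orthogonal projection, so the left side is the mean square of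
  \<open>f - cyc_avg T m f\<close>. By Jensen this is at most the average over \<open>d < m\<close>
  of the mean square change under \<open>T ^^ d\<close>, which costs a factor \<open>d ^ 2\<close>.
  The resulting order \<open>m ^ 2\<close> later cancels against a squared step length of order
  \<open>1 / m ^ 2\<close>.\<close>

lemma avg_variance_cyc_avg:
  assumes T: "bij_betw T X X" and m: "m > 0" and per: "\<And>x. x \<in> X \<Longrightarrow> (T ^^ m) x = x"
  shows "avg X (\<lambda>x. (f x)\<^sup>2) - avg X (\<lambda>x. (cyc_avg T m f x)\<^sup>2)
    \<le> (real m)\<^sup>2 / 3 * avg X (\<lambda>x. (f (T x) - f x)\<^sup>2)"
proof -
  let ?P = "cyc_avg T m f"
  have TX: "T x \<in> X" if "x \<in> X" for x
    using T that by (auto simp: bij_betw_def)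
  have TdX: "(T ^^ d) x \<in> X" if "x \<in> X" for x d
    by (induction d) (use that TX in auto)
  have inv: "?P ((T ^^ d) x) = ?P x" if "x \<in> X" for x d
  proof (induction d)
    case (Suc d)
    then show ?case using cyc_avg_invariant[where T = T and m = m and x = "(T ^^ d) x" and f = f] per[OF TdX[OF that]] by simp
  qed simp
  \<comment> \<open>Orthogonality of \<open>f - ?P\<close> to \<open>?P\<close>: shifting by
    \<open>T ^^ d\<close> moves \<open>f\<close> but not the invariant \<open>?P\<close>, and
    averaging the shifts over \<open>d\<close> turns \<open>f\<close> into
    \<open>?P\<close>.\<close>
  have cross: "avg X (\<lambda>x. f x * ?P x) = avg X (\<lambda>x. (?P x)\<^sup>2)"
  proof -
    have eq: "avg X (\<lambda>x. f x * ?P x) = avg X (\<lambda>x. f ((T ^^ d) x) * ?P x)" for d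
    proof -
      have "avg X (\<lambda>x. f x * ?P x) = avg X (\<lambda>x. f ((T ^^ d) x) * ?P ((T ^^ d) x))"
        by (rule avg_bij[OF bij_betw_funpow[OF T], of "\<lambda>x. f x * ?P x", symmetric])
      also have "\<dots> = avg X (\<lambda>x. f ((T ^^ d) x) * ?P x)"
        by (intro avg_cong) (simp add: inv)
      finally show ?thesis .
    qed
    have "real m * avg X (\<lambda>x. f x * ?P x) = (\<Sum>d<m. avg X (\<lambda>x. f x * ?P x))"
      by simp
    also have "\<dots> = (\<Sum>d<m. avg X (\<lambda>x. f ((T ^^ d) x) * ?P x))"
      by (intro sum.cong refl eq)
    also have "\<dots> = avg X (\<lambda>x. \<Sum>d<m. f ((T ^^ d) x) * ?P x)"
      by (simp only: avg_sum)
    also have "\<dots> = avg X (\<lambda>x. real m * (?P x)\<^sup>2)"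
    proof (intro avg_cong)
      fix x
      have "(\<Sum>d<m. f ((T ^^ d) x)) = real m * ?P x" using m by (simp add: cyc_avg_def)
      then show "(\<Sum>d<m. f ((T ^^ d) x) * ?P x) = real m * (?P x)\<^sup>2"
        by (simp add: power2_eq_square flip: sum_distrib_right)
    qed
    finally show ?thesis using m by (simp add: avg_cmult)
  qed
  have "avg X (\<lambda>x. (f x - ?P x)\<^sup>2) = avg X (\<lambda>x. ((f x)\<^sup>2 - 2 * (f x * ?P x)) + (?P x)\<^sup>2)"
    by (intro avg_cong) (simp add: power2_eq_square algebra_simps)
  also have "\<dots> = avg X (\<lambda>x. (f x)\<^sup>2) - avg X (\<lambda>x. (?P x)\<^sup>2)"
    by (simp only: avg_add avg_diff avg_cmult cross)
  finally have "avg X (\<lambda>x. (f x)\<^sup>2) - avg X (\<lambda>x. (?P x)\<^sup>2) = avg X (\<lambda>x. (f x - ?P x)\<^sup>2)" by simp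
  also have "\<dots> \<le> avg X (\<lambda>x. (\<Sum>d<m. (f ((T ^^ d) x) - f x)\<^sup>2) / real m)"
  proof (intro avg_mono)
    fix x
    have "?P x - f x = (\<Sum>d<m. f ((T ^^ d) x) - f x) / real m"
      using m by (simp add: cyc_avg_def sum_subtractf diff_divide_distrib)
    then show "(f x - ?P x)\<^sup>2 \<le> (\<Sum>d<m. (f ((T ^^ d) x) - f x)\<^sup>2) / real m"
      using square_mean_le[of "\<lambda>d. f ((T ^^ d) x) - f x" m] power2_commute[of "f x" "?P x"] by simp
  qed
  also have "\<dots> = (\<Sum>d<m. avg X (\<lambda>x. (f ((T ^^ d) x) - f x)\<^sup>2)) / real m"
    by (simp only: avg_cdiv avg_sum)
  also have "\<dots> \<le> (\<Sum>d<m. (real d)\<^sup>2 * avg X (\<lambda>x. (f (T x) - f x)\<^sup>2)) / real m"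
    by (intro divide_right_mono sum_mono avg_square_diff_funpow[OF T]) simp
  also have "\<dots> = (\<Sum>d<m. (real d)\<^sup>2) / real m * avg X (\<lambda>x. (f (T x) - f x)\<^sup>2)"
    by (simp add: sum_distrib_right)
  also have "\<dots> \<le> (real m ^ 3 / 3) / real m * avg X (\<lambda>x. (f (T x) - f x)\<^sup>2)"
    by (intro mult_right_mono divide_right_mono sum_squares_le_cube avg_nonneg) auto
  also have "\<dots> = (real m)\<^sup>2 / 3 * avg X (\<lambda>x. (f (T x) - f x)\<^sup>2)"
    using m by (simp add: power2_eq_square power3_eq_cube)
  finally show ?thesis .
qed

text \<open>Tensorisation: the directions are averaged out one after another. Because the actions
  commute, each averaging keeps the invariances already gained and does not increase the energy in
  any direction, so every loss of second moment can be charged to the energy of the original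
  \<open>f\<close>.\<close>

lemma poincare_partial_average:
  fixes T :: "'i \<Rightarrow> 'a \<Rightarrow> 'a"
  assumes T: "\<And>i. bij_betw (T i) X X" and m: "m > 0"
    and per: "\<And>i x. x \<in> X \<Longrightarrow> (T i ^^ m) x = x"
    and comm: "\<And>i j x. x \<in> X \<Longrightarrow> T i (T j x) = T j (T i x)"
    and J: "finite J"
  shows "\<exists>f'. avg X f' = avg X f \<and> (\<forall>i\<in>J. \<forall>x\<in>X. f' (T i x) = f' x) \<and>
    (\<forall>i. avg X (\<lambda>x. (f' (T i x) - f' x)\<^sup>2) \<le> avg X (\<lambda>x. (f (T i x) - f x)\<^sup>2)) \<and>
    avg X (\<lambda>x. (f x)\<^sup>2) - avg X (\<lambda>x. (f' x)\<^sup>2)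
      \<le> (real m)\<^sup>2 / 3 * (\<Sum>i\<in>J. avg X (\<lambda>x. (f (T i x) - f x)\<^sup>2))"
  using J
proof (induction J rule: finite_induct)
  case empty
  show ?case by (intro exI[of _ f]) auto
next
  case (insert j J)
  have TdX: "(T j ^^ d) x \<in> X" if "x \<in> X" for x d
    using bij_betw_funpow[OF T[of j], of d] that by (auto simp: bij_betw_def)
  have commd: "(T j ^^ d) (T i x) = T i ((T j ^^ d) x)" if "x \<in> X" for i x d
  proof (induction d)
    case (Suc d)
    then show ?case using comm[OF TdX[OF that]] by simp
  qed simp
  from insert.IH obtain f' where f': "avg X f' = avg X f"
    "\<And>i x. i \<in> J \<Longrightarrow> x \<in> X \<Longrightarrow> f' (T i x) = f' x"
    "\<And>i. avg X (\<lambda>x. (f' (T i x) - f' x)\<^sup>2) \<le> avg X (\<lambda>x. (f (T i x) - f x)\<^sup>2)"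
    "avg X (\<lambda>x. (f x)\<^sup>2) - avg X (\<lambda>x. (f' x)\<^sup>2)
      \<le> (real m)\<^sup>2 / 3 * (\<Sum>i\<in>J. avg X (\<lambda>x. (f (T i x) - f x)\<^sup>2))" by blast
  let ?g = "cyc_avg (T j) m f'"
  have g_shift: "?g (T i x) = (\<Sum>d<m. f' (T i ((T j ^^ d) x))) / real m" if "x \<in> X" for i x
    unfolding cyc_avg_def using commd[OF that] by simp
  \<comment> \<open>By commutation the increment of \<open>?g\<close> in direction \<open>i\<close>
    is the cyclic average of the increments of \<open>f'\<close>, so convexity of the square
    applies.\<close>
  have "avg X (\<lambda>x. (?g (T i x) - ?g x)\<^sup>2) \<le> avg X (\<lambda>x. (f' (T i x) - f' x)\<^sup>2)" for i
  proof -
    let ?D = "\<lambda>x. f' (T i x) - f' x"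
    have "avg X (\<lambda>x. (?g (T i x) - ?g x)\<^sup>2)
        \<le> avg X (\<lambda>x. (\<Sum>d<m. (?D ((T j ^^ d) x))\<^sup>2) / real m)"
    proof (intro avg_mono)
      fix x assume x: "x \<in> X"
      have "?g (T i x) - ?g x = (\<Sum>d<m. ?D ((T j ^^ d) x)) / real m"
        unfolding g_shift[OF x] by (simp add: cyc_avg_def sum_subtractf diff_divide_distrib)
      then show "(?g (T i x) - ?g x)\<^sup>2 \<le> (\<Sum>d<m. (?D ((T j ^^ d) x))\<^sup>2) / real m"
        using square_mean_le[of "\<lambda>d. ?D ((T j ^^ d) x)" m] by simp
    qed
    also have "\<dots> = (\<Sum>d<m. avg X (\<lambda>x. (?D ((T j ^^ d) x))\<^sup>2)) / real m"
      by (simp only: avg_cdiv avg_sum)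
    also have "\<dots> = avg X (\<lambda>x. (?D x)\<^sup>2)"
      using avg_bij[OF bij_betw_funpow[OF T], of "\<lambda>x. (?D x)\<^sup>2"] m by simp
    finally show ?thesis .
  qed
  moreover have "?g (T i x) = ?g x" if "i \<in> insert j J" "x \<in> X" for i x
  proof (cases "i = j")
    case True
    then show ?thesis using cyc_avg_invariant[OF per[OF that(2)]] by blast
  next
    case False
    then show ?thesis
      unfolding g_shift[OF that(2)] using f'(2) that TdX by (simp add: cyc_avg_def)
  qed
  moreover have "avg X (\<lambda>x. (f x)\<^sup>2) - avg X (\<lambda>x. (?g x)\<^sup>2)
      \<le> (real m)\<^sup>2 / 3 * (\<Sum>i\<in>insert j J. avg X (\<lambda>x. (f (T i x) - f x)\<^sup>2))"
  proof -
    have "avg X (\<lambda>x. (f' x)\<^sup>2) - avg X (\<lambda>x. (?g x)\<^sup>2)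
        \<le> (real m)\<^sup>2 / 3 * avg X (\<lambda>x. (f' (T j x) - f' x)\<^sup>2)"
      by (rule avg_variance_cyc_avg[OF T m per])
    also have "\<dots> \<le> (real m)\<^sup>2 / 3 * avg X (\<lambda>x. (f (T j x) - f x)\<^sup>2)"
      by (intro mult_left_mono f'(3)) simp
    finally show ?thesis using f'(4) insert.hyps by (simp add: algebra_simps)
  qed
  moreover have "avg X ?g = avg X f" using avg_cyc_avg[OF T m] f'(1) by simp
  ultimately show ?case using order_trans[OF _ f'(3)] by (intro exI[of _ ?g]) blast
qed

text \<open>Transitivity of the commuting cyclic actions is expressed by the last assumption: invariant
  functions are constant.\<close>

theorem poincare_commuting_rotations:
  fixes T :: "'i::finite \<Rightarrow> 'a \<Rightarrow> 'a"
  assumes X: "finite X" "X \<noteq> {}"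
    and T: "\<And>i. bij_betw (T i) X X" and m: "m > 0"
    and per: "\<And>i x. x \<in> X \<Longrightarrow> (T i ^^ m) x = x"
    and comm: "\<And>i j x. x \<in> X \<Longrightarrow> T i (T j x) = T j (T i x)"
    and trans: "\<And>f :: 'a \<Rightarrow> real. (\<And>i x. x \<in> X \<Longrightarrow> f (T i x) = f x) \<Longrightarrow> \<exists>c. \<forall>x\<in>X. f x = c"
  shows "avg X (\<lambda>x. (f x)\<^sup>2) - (avg X f)\<^sup>2
    \<le> (real m)\<^sup>2 / 3 * (\<Sum>i\<in>UNIV. avg X (\<lambda>x. (f (T i x) - f x)\<^sup>2))"
proof -
  obtain f' where f': "avg X f' = avg X f" "\<And>i x. x \<in> X \<Longrightarrow> f' (T i x) = f' x"
    "avg X (\<lambda>x. (f x)\<^sup>2) - avg X (\<lambda>x. (f' x)\<^sup>2)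
      \<le> (real m)\<^sup>2 / 3 * (\<Sum>i\<in>UNIV. avg X (\<lambda>x. (f (T i x) - f x)\<^sup>2))"
    using poincare_partial_average[of T X m UNIV f, OF T m per comm finite] by blast
  obtain c where c: "\<And>x. x \<in> X \<Longrightarrow> f' x = c" using trans[OF f'(2)] by blast
  have "avg X f' = c" "avg X (\<lambda>x. (f' x)\<^sup>2) = c\<^sup>2"
    using avg_cong[of X f' "\<lambda>_. c"] avg_cong[of X "\<lambda>x. (f' x)\<^sup>2" "\<lambda>_. c\<^sup>2"] c avg_const[OF X]
    by auto
  then show ?thesis using f' by simp
qed

section \<open>Products of roots of unity and Glynn's formula\<close>

definition root_grid :: "nat \<Rightarrow> ('n \<Rightarrow> complex) set" where
  "root_grid m = {x. \<forall>j. x j ^ m = 1}"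

definition rotate_coord :: "complex \<Rightarrow> 'n \<Rightarrow> ('n \<Rightarrow> complex) \<Rightarrow> 'n \<Rightarrow> complex" where
  "rotate_coord w j x = x(j := w * x j)"

lemma finite_root_grid:
  assumes "m > 0"
  shows "finite (root_grid m :: ('n::finite \<Rightarrow> complex) set)"
proof -
  have "finite {z :: complex. z ^ m = 1}"
    using card_complex_roots_unity[of m] assms by (intro card_ge_0_finite) simp
  then have "finite (PiE (UNIV :: 'n set) (\<lambda>_. {z :: complex. z ^ m = 1}))"
    by (intro finite_PiE) auto
  moreover have "root_grid m = PiE (UNIV :: 'n set) (\<lambda>_. {z :: complex. z ^ m = 1})"
    by (auto simp: root_grid_def PiE_def)
  ultimately show ?thesis by simp
qed

lemma root_grid_nonempty: "root_grid m \<noteq> {}"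
proof -
  have "(\<lambda>_. 1) \<in> root_grid m" by (simp add: root_grid_def)
  then show ?thesis by blast
qed

lemma cmod_root_of_unity: "z ^ m = 1 \<Longrightarrow> m > 0 \<Longrightarrow> cmod z = 1"
  by (metis norm_one norm_power norm_ge_zero power_eq_imp_eq_base power_one zero_le_one)

lemma cmod_root_grid: "x \<in> root_grid m \<Longrightarrow> m > 0 \<Longrightarrow> cmod (x j) = 1"
  by (auto simp: root_grid_def intro: cmod_root_of_unity)

lemma bij_betw_root_grid_mult:
  assumes "c \<in> root_grid m" "m > 0"
  shows "bij_betw (\<lambda>x j. c j * x j) (root_grid m) (root_grid m)"
proof -
  have "c j \<noteq> 0" for j using cmod_root_grid[OF assms, of j] by auto
  then show ?thesis
    using assms(1) by (intro bij_betw_byWitness[where f' = "\<lambda>x j. inverse (c j) * x j"])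
      (auto simp: root_grid_def power_mult_distrib power_inverse)
qed

lemma rotate_coord_eq_mult: "rotate_coord w j x = (\<lambda>i. (if i = j then w else 1) * x i)"
  by (auto simp: rotate_coord_def)

lemma bij_betw_rotate_coord:
  assumes "w ^ m = 1" "m > 0"
  shows "bij_betw (rotate_coord w j) (root_grid m) (root_grid m)"
proof -
  have "(\<lambda>i. if i = j then w else 1) \<in> root_grid m"
    using assms by (simp add: root_grid_def)
  from bij_betw_root_grid_mult[OF this assms(2)] show ?thesis
    by (simp add: rotate_coord_eq_mult[abs_def])
qed

lemma rotate_coord_funpow: "(rotate_coord w j ^^ d) x = x(j := w ^ d * x j)"
  by (induction d) (auto simp: rotate_coord_def)

text \<open>The rotations act transitively: every \<open>m\<close>-th root of unity is a power of
  the primitive one, so coordinates can be reset to \<open>1\<close> one at a time until the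
  constant vector is reached.\<close>

lemma rotation_invariant_imp_const:
  fixes f :: "('n::finite \<Rightarrow> complex) \<Rightarrow> real"
  assumes m: "m > 0"
    and inv: "\<And>j x. x \<in> root_grid m \<Longrightarrow> f (rotate_coord (cis (2 * pi / real m)) j x) = f x"
  shows "\<exists>c. \<forall>x\<in>root_grid m. f x = c"
proof -
  let ?w = "cis (2 * pi / real m)"
  have w: "?w ^ m = 1" using m by (simp add: Complex.DeMoivre)
  have pow: "f ((rotate_coord ?w j ^^ d) x) = f x" if "x \<in> root_grid m" for j d x
  proof (induction d)
    case (Suc d)
    have "(rotate_coord ?w j ^^ d) x \<in> root_grid m"
      by (rule bij_betwE[OF bij_betw_funpow[OF bij_betw_rotate_coord[OF w m]], rule_format, OF that])
    from inv[OF this, of j] show ?case using Suc by simp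
  qed simp
  have "f x = f (\<lambda>i. if i \<in> J then 1 else x i)" if x: "x \<in> root_grid m" and "finite J" for x J
    using that(2)
  proof (induction J rule: finite_induct)
    case (insert j J)
    let ?y = "\<lambda>i. if i \<in> insert j J then 1 else x i"
    have y: "?y \<in> root_grid m" using x by (auto simp: root_grid_def)
    have "x j ^ m = 1" using x by (auto simp: root_grid_def)
    then obtain d where "x j = cis (2 * pi * real d / real m)"
      using Complex.bij_betw_roots_unity[OF m] by (auto simp: bij_betw_def)
    then have d: "x j = ?w ^ d" by (simp add: Complex.DeMoivre mult_ac)
    \<comment> \<open>\<open>?y\<close> has a \<open>1\<close> at \<open>j\<close>; rotating it
      \<open>d\<close> times restores \<open>x j\<close>.\<close>
    have "(\<lambda>i. if i \<in> J then 1 else x i) = (rotate_coord ?w j ^^ d) ?y"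
      using insert.hyps d by (auto simp: rotate_coord_funpow)
    then show ?case using insert.IH pow[OF y] by simp
  qed simp
  from this[OF _ finite[of UNIV]] show ?thesis by auto
qed

theorem poincare_root_grid:
  fixes f :: "('n::finite \<Rightarrow> complex) \<Rightarrow> real"
  assumes m: "m > 0"
  defines "w \<equiv> cis (2 * pi / real m)"
  shows "avg (root_grid m) (\<lambda>x. (f x)\<^sup>2) - (avg (root_grid m) f)\<^sup>2
    \<le> (real m)\<^sup>2 / 3 * (\<Sum>j\<in>UNIV. avg (root_grid m) (\<lambda>x. (f (rotate_coord w j x) - f x)\<^sup>2))"
proof (rule poincare_commuting_rotations)
  have w: "w ^ m = 1" unfolding w_def using m by (simp add: Complex.DeMoivre)
  show "bij_betw (rotate_coord w j) (root_grid m) (root_grid m)" for j :: 'n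
    by (rule bij_betw_rotate_coord[OF w m])
  show "(rotate_coord w j ^^ m) x = x" for j :: 'n and x
    by (simp add: rotate_coord_funpow w)
  show "rotate_coord w i (rotate_coord w j x) = rotate_coord w j (rotate_coord w i x)"
    for i j :: 'n and x
    by (auto simp: rotate_coord_def)
  show "\<exists>c. \<forall>x\<in>root_grid m. f x = c"
    if "\<And>j x. x \<in> root_grid m \<Longrightarrow> f (rotate_coord w j x) = f x"
    for f :: "('n \<Rightarrow> complex) \<Rightarrow> real"
    using rotation_invariant_imp_const[OF m] that unfolding w_def by blast
qed (auto simp: m finite_root_grid root_grid_nonempty)

section \<open>The permanent as an average over the grid of roots of unity\<close>

definition row_form :: "real^'n^'n \<Rightarrow> ('n \<Rightarrow> complex) \<Rightarrow> 'n \<Rightarrow> complex" where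
  "row_form A x i = (\<Sum>j\<in>UNIV. of_real (A $ i $ j) * x j)"

text \<open>Expanding the product of row forms gives one monomial for each map \<open>f\<close> of
  the index set. If \<open>f\<close> is a permutation, the conjugate factors cancel the monomial.
  Otherwise \<open>f\<close> misses some \<open>j\<close>, and rotating coordinate \<open>j\<close>
  multiplies the term by \<open>cnj w\<close>, which differs from \<open>1\<close> because
  \<open>m > 1\<close>; the sum over the grid then vanishes.\<close>

theorem glynn_formula:
  fixes A :: "real^'n^'n"
  assumes m: "m > 1"
  shows "(\<Sum>x\<in>root_grid m. (\<Prod>j\<in>UNIV. cnj (x j)) * (\<Prod>i\<in>UNIV. row_form A x i))
    = of_nat (card (root_grid m :: ('n \<Rightarrow> complex) set)) * of_real (perm A)"
proof -
  let ?X = "root_grid m :: ('n \<Rightarrow> complex) set"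
  let ?w = "cis (2 * pi / real m)"
  have m0: "m > 0" using m by simp
  have w: "?w ^ m = 1" using m by (simp add: Complex.DeMoivre)
  have w1: "?w \<noteq> 1"
  proof
    assume "?w = 1"
    moreover have "inj_on (\<lambda>k. cis (2 * pi * real k / real m)) {..<m}"
      using Complex.bij_betw_roots_unity[OF m0] by (auto simp: bij_betw_def)
    ultimately show False using m inj_onD[of _ "{..<m}" 0 1] by fastforce
  qed
  let ?t = "\<lambda>(f :: 'n \<Rightarrow> 'n) x. (\<Prod>j\<in>UNIV. cnj (x j)) * (\<Prod>i\<in>UNIV. x (f i))"
  have one: "?t f x = 1" if "f permutes UNIV" "x \<in> ?X" for f x
  proof -
    have "(\<Prod>i\<in>UNIV. x (f i)) = (\<Prod>i\<in>UNIV. x i)"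
      using prod.permute[OF that(1), of x] by (simp add: comp_def)
    moreover have "cnj (x j) * x j = 1" for j
      using cmod_root_grid[OF that(2) m0, of j] by (simp add: complex_norm_square[symmetric] mult.commute)
    ultimately show ?thesis by (simp flip: prod.distrib)
  qed
  have zero: "(\<Sum>x\<in>?X. ?t f x) = 0" if "\<not> f permutes UNIV" for f
  proof -
    have "\<not> surj f"
      using that finite_UNIV_surj_inj[OF finite, of f] bij_imp_permutes[of f UNIV] by (auto simp: bij_def)
    then obtain j where j: "\<And>i. f i \<noteq> j" by (metis surjI)
    have "?t f (rotate_coord ?w j x) = cnj ?w * ?t f x" for x
    proof -
      have "(\<Prod>i\<in>UNIV. cnj (rotate_coord ?w j x i))
          = (\<Prod>i\<in>UNIV. (if i = j then cnj ?w else 1) * cnj (x i))"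
        by (intro prod.cong) (auto simp: rotate_coord_def)
      also have "\<dots> = cnj ?w * (\<Prod>i\<in>UNIV. cnj (x i))"
        by (simp add: prod.distrib)
      finally show ?thesis using j by (simp add: rotate_coord_def)
    qed
    then have "(\<Sum>x\<in>?X. ?t f x) = cnj ?w * (\<Sum>x\<in>?X. ?t f x)"
      using sum.reindex_bij_betw[OF bij_betw_rotate_coord[OF w m0], of "?t f" j]
      by (simp add: sum_distrib_left)
    then have "(1 - cnj ?w) * (\<Sum>x\<in>?X. ?t f x) = 0" by (simp add: algebra_simps)
    moreover have "1 - cnj ?w \<noteq> 0" using w1 by (metis complex_cnj_cancel_iff complex_cnj_one eq_iff_diff_eq_0)
    ultimately show ?thesis unfolding mult_eq_0_iff by blast
  qed
  have expand: "(\<Prod>i\<in>UNIV. row_form A x i)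
      = (\<Sum>f\<in>UNIV. (\<Prod>i\<in>UNIV. of_real (A $ i $ f i)) * (\<Prod>i\<in>UNIV. x (f i)))" for x
    unfolding row_form_def by (subst prod_sum_PiE) (auto simp: prod.distrib)
  have "(\<Sum>x\<in>?X. (\<Prod>j\<in>UNIV. cnj (x j)) * (\<Prod>i\<in>UNIV. row_form A x i))
      = (\<Sum>x\<in>?X. \<Sum>f\<in>UNIV. (\<Prod>i\<in>UNIV. of_real (A $ i $ f i)) * ?t f x)"
    unfolding expand by (simp add: sum_distrib_left mult_ac)
  also have "\<dots> = (\<Sum>f\<in>UNIV. (\<Prod>i\<in>UNIV. of_real (A $ i $ f i)) * (\<Sum>x\<in>?X. ?t f x))"
    by (subst sum.swap) (simp add: sum_distrib_left)
  also have "\<dots> = (\<Sum>f | f permutes UNIV. (\<Prod>i\<in>UNIV. of_real (A $ i $ f i)) * (\<Sum>x\<in>?X. ?t f x))"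
    using zero by (intro sum.mono_neutral_right) auto
  also have "\<dots> = (\<Sum>f | f permutes UNIV. (\<Prod>i\<in>UNIV. of_real (A $ i $ f i)) * of_nat (card ?X))"
    using one by (intro sum.cong) auto
  also have "\<dots> = of_nat (card ?X) * of_real (perm A)"
    by (simp add: perm_def sum_distrib_left mult.commute)
  finally show ?thesis .
qed

theorem perm_le_avg_exp:
  fixes A :: "real^'n^'n"
  assumes m: "m > 1"
  shows "\<bar>perm A\<bar> \<le> avg (root_grid m) (\<lambda>x. exp (\<Sum>i\<in>UNIV. cmod (row_form A x i) - 1))"
proof -
  let ?X = "root_grid m :: ('n \<Rightarrow> complex) set"
  have m0: "m > 0" using m by simp
  have card: "real (card ?X) > 0"
    using finite_root_grid[OF m0, where 'n = 'n] root_grid_nonempty by (simp add: card_gt_0_iff)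
  have "real (card ?X) * \<bar>perm A\<bar>
      = cmod (\<Sum>x\<in>?X. (\<Prod>j\<in>UNIV. cnj (x j)) * (\<Prod>i\<in>UNIV. row_form A x i))"
    unfolding glynn_formula[OF m] by (simp add: norm_mult)
  also have "\<dots> \<le> (\<Sum>x\<in>?X. exp (\<Sum>i\<in>UNIV. cmod (row_form A x i) - 1))"
  proof (intro sum_norm_le)
    fix x assume x: "x \<in> ?X"
    have "cmod ((\<Prod>j\<in>UNIV. cnj (x j)) * (\<Prod>i\<in>UNIV. row_form A x i))
        = (\<Prod>i\<in>UNIV. cmod (row_form A x i))"
      using cmod_root_grid[OF x m0] by (simp add: norm_mult flip: prod_norm)
    also have "\<dots> \<le> (\<Prod>i\<in>UNIV. exp (cmod (row_form A x i) - 1))"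
      using exp_ge_add_one_self[of "cmod (row_form A x _) - 1"] by (intro prod_mono) auto
    also have "\<dots> = exp (\<Sum>i\<in>UNIV. cmod (row_form A x i) - 1)" by (simp add: exp_sum)
    finally show "cmod ((\<Prod>j\<in>UNIV. cnj (x j)) * (\<Prod>i\<in>UNIV. row_form A x i))
      \<le> exp (\<Sum>i\<in>UNIV. cmod (row_form A x i) - 1)" .
  qed
  finally show ?thesis using card by (simp add: avg_def field_simps)
qed

section \<open>The deficit of a contraction\<close>

text \<open>The transpose of a contraction is a contraction: pair \<open>z v* A\<close> with itself,
  move \<open>A\<close> to the other side and apply Cauchy-Schwarz.\<close>

lemma norm_vector_matrix_mult_le:
  fixes A :: "real^'n^'n"
  assumes "onorm (\<lambda>x. A *v x) \<le> 1"
  shows "norm (z v* A) \<le> norm z"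
proof -
  have "norm (A *v y) \<le> norm y" for y
  proof -
    have "norm (A *v y) \<le> onorm (\<lambda>x. A *v x) * norm y"
      by (intro onorm linear_linear[THEN iffD2] matrix_vector_mul_linear)
    also have "\<dots> \<le> norm y" using assms mult_right_mono[of _ 1 "norm y"] by simp
    finally show ?thesis .
  qed
  note contr = this
  have "norm (z v* A) * norm (z v* A) = inner z (A *v (z v* A))"
    by (simp add: dot_lmul_matrix flip: power2_eq_square power2_norm_eq_inner)
      (simp add: power2_norm_eq_inner dot_lmul_matrix)
  also have "\<dots> \<le> norm z * norm (A *v (z v* A))" by (rule norm_cauchy_schwarz)
  also have "\<dots> \<le> norm z * norm (z v* A)" by (intro mult_left_mono contr) simp
  finally show ?thesis
    by (cases "norm (z v* A) = 0") auto
qed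

text \<open>\<open>A\<close> is real, so real and imaginary parts of \<open>u\<close> are
  transformed separately and the real contraction bound applies to each.\<close>

lemma sum_cmod_square_transpose_le:
  fixes A :: "real^'n^'n" and u :: "'n \<Rightarrow> complex"
  assumes "onorm (\<lambda>x. A *v x) \<le> 1"
  shows "(\<Sum>j\<in>UNIV. (cmod (\<Sum>i\<in>UNIV. of_real (A $ i $ j) * u i))\<^sup>2) \<le> (\<Sum>i\<in>UNIV. (cmod (u i))\<^sup>2)"
proof -
  have real: "(\<Sum>j\<in>UNIV. (\<Sum>i\<in>UNIV. A $ i $ j * z i)\<^sup>2) \<le> (\<Sum>i\<in>UNIV. (z i)\<^sup>2)" for z :: "'n \<Rightarrow> real"
  proof -
    have "(norm ((\<chi> i. z i) v* A))\<^sup>2 \<le> (norm (\<chi> i. z i))\<^sup>2"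
      using norm_vector_matrix_mult_le[OF assms] by (intro power_mono) auto
    then show ?thesis
      unfolding power2_norm_eq_inner inner_vec_def vector_matrix_mult_def
      by (simp add: power2_eq_square mult.commute)
  qed
  have "(\<Sum>j\<in>UNIV. (cmod (\<Sum>i\<in>UNIV. of_real (A $ i $ j) * u i))\<^sup>2)
      = (\<Sum>j\<in>UNIV. (\<Sum>i\<in>UNIV. A $ i $ j * Re (u i))\<^sup>2) + (\<Sum>j\<in>UNIV. (\<Sum>i\<in>UNIV. A $ i $ j * Im (u i))\<^sup>2)"
    by (simp add: cmod_power2 sum.distrib)
  also have "\<dots> \<le> (\<Sum>i\<in>UNIV. (Re (u i))\<^sup>2) + (\<Sum>i\<in>UNIV. (Im (u i))\<^sup>2)"
    by (intro add_mono real)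
  also have "\<dots> = (\<Sum>i\<in>UNIV. (cmod (u i))\<^sup>2)"
    by (simp add: cmod_power2 sum.distrib)
  finally show ?thesis .
qed

definition deficit :: "real^'n^'n \<Rightarrow> ('n \<Rightarrow> complex) \<Rightarrow> real" where
  "deficit A x = 2 * (\<Sum>i\<in>UNIV. 1 - cmod (row_form A x i))"

text \<open>The deficit is a minimum over unimodular vectors \<open>u\<close> of affine functions of \<open>x\<close>; the bound
  freezes the optimal \<open>u\<close> and takes \<open>p\<close> to be the coordinatewise distance of \<open>A\<^sup>T u\<close> to \<open>x\<close>.\<close>

lemma deficit_rotate_coord_le:
  fixes A :: "real^'n^'n"
  assumes A: "onorm (\<lambda>x. A *v x) \<le> 1" and x: "\<And>j. cmod (x j) = 1"
  shows "\<exists>p. (\<forall>j. 0 \<le> p j) \<and> (\<Sum>j\<in>UNIV. (p j)\<^sup>2) \<le> deficit A x \<and>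
    (\<forall>j w. cmod w = 1 \<longrightarrow>
      deficit A (rotate_coord w j x) \<le> deficit A x + cmod (w - 1) * (2 * p j + cmod (w - 1)))"
proof -
  \<comment> \<open>The optimal phases at \<open>x\<close>. Where the row form vanishes any phase is
    optimal, and the default \<open>1\<close> keeps \<open>u\<close> unimodular.\<close>
  define u where "u i = (if row_form A x i = 0 then 1 else sgn (row_form A x i))" for i
  define v where "v j = (\<Sum>i\<in>UNIV. of_real (A $ i $ j) * u i)" for j
  have u1: "cmod (u i) = 1" for i by (simp add: u_def norm_sgn)
  have uy: "Re (cnj (u i) * row_form A x i) = cmod (row_form A x i)" for i
  proof (cases "row_form A x i = 0")
    case False
    then have "cnj (u i) * row_form A x i = of_real (cmod (row_form A x i))"
      using complex_norm_square[of "row_form A x i"]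
      by (simp add: u_def sgn_eq field_simps power2_eq_square)
    then show ?thesis by simp
  qed (simp add: u_def)
  have pair: "(\<Sum>i\<in>UNIV. cnj (u i) * row_form A z i) = (\<Sum>j\<in>UNIV. z j * cnj (v j))" for z
  proof -
    have "(\<Sum>i\<in>UNIV. cnj (u i) * row_form A z i)
        = (\<Sum>i\<in>UNIV. \<Sum>j\<in>UNIV. of_real (A $ i $ j) * cnj (u i) * z j)"
      by (simp add: row_form_def sum_distrib_left mult_ac)
    also have "\<dots> = (\<Sum>j\<in>UNIV. z j * cnj (v j))"
      by (subst sum.swap) (simp add: v_def sum_distrib_left mult_ac)
    finally show ?thesis .
  qed
  have def_x: "deficit A x = 2 * real CARD('n) - 2 * Re (\<Sum>j\<in>UNIV. x j * cnj (v j))"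
    by (simp add: deficit_def sum_subtractf uy[symmetric] pair[symmetric])
  have def_le: "deficit A z \<le> 2 * real CARD('n) - 2 * Re (\<Sum>j\<in>UNIV. z j * cnj (v j))" for z
  proof -
    have "Re (cnj (u i) * row_form A z i) \<le> cmod (row_form A z i)" for i
      using complex_Re_le_cmod[of "cnj (u i) * row_form A z i"] u1 by (simp add: norm_mult)
    then have "Re (\<Sum>i\<in>UNIV. cnj (u i) * row_form A z i) \<le> (\<Sum>i\<in>UNIV. cmod (row_form A z i))"
      unfolding Re_sum by (intro sum_mono)
    then show ?thesis by (simp add: deficit_def sum_subtractf pair[symmetric])
  qed
  define p where "p j = cmod (v j - x j)" for j
  have "(\<Sum>j\<in>UNIV. (p j)\<^sup>2) = (\<Sum>j\<in>UNIV. (cmod (v j))\<^sup>2 + 1 - 2 * Re (x j * cnj (v j)))"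
  proof (intro sum.cong refl)
    fix j
    have "(Re (x j))\<^sup>2 + (Im (x j))\<^sup>2 = 1" using x[of j] cmod_power2[of "x j"] by simp
    then show "(p j)\<^sup>2 = (cmod (v j))\<^sup>2 + 1 - 2 * Re (x j * cnj (v j))"
      unfolding p_def cmod_power2 by (simp add: power2_eq_square algebra_simps)
  qed
  also have "\<dots> = (\<Sum>j\<in>UNIV. (cmod (v j))\<^sup>2) + real CARD('n) - 2 * Re (\<Sum>j\<in>UNIV. x j * cnj (v j))"
    by (simp add: sum.distrib sum_subtractf sum_distrib_left)
  \<comment> \<open>Contraction of the transpose bounds the squared norm of \<open>v\<close> by that
    of \<open>u\<close>, which is \<open>CARD('n)\<close>.\<close>
  also have "\<dots> \<le> deficit A x"
    using sum_cmod_square_transpose_le[OF A, of u] u1 unfolding def_x v_def by simp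
  finally have "(\<Sum>j\<in>UNIV. (p j)\<^sup>2) \<le> deficit A x" .
  moreover have "deficit A (rotate_coord w j x) \<le> deficit A x + cmod (w - 1) * (2 * p j + cmod (w - 1))"
    if w: "cmod w = 1" for j w
  proof -
    have "(\<Sum>i\<in>UNIV. rotate_coord w j x i * cnj (v i))
        = (\<Sum>i\<in>UNIV. x i * cnj (v i) + (if i = j then (w - 1) * x j * cnj (v j) else 0))"
      by (intro sum.cong) (auto simp: rotate_coord_def algebra_simps)
    also have "\<dots> = (\<Sum>i\<in>UNIV. x i * cnj (v i)) + (w - 1) * x j * cnj (v j)"
      by (simp add: sum.distrib)
    finally have "deficit A (rotate_coord w j x) \<le> deficit A x - 2 * Re ((w - 1) * x j * cnj (v j))"
      using def_le[of "rotate_coord w j x"] unfolding def_x by simp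
    \<comment> \<open>Splitting off \<open>x j\<close> from \<open>v j\<close> isolates the
      first-order term controlled by \<open>p j\<close>; the rest is second order, as
      \<open>- 2 * Re (w - 1)\<close> is the squared chord for unimodular \<open>w\<close>.\<close>
    also have "(w - 1) * x j * cnj (v j) = (w - 1) * x j * cnj (v j - x j) + (w - 1)"
      using x[of j] complex_norm_square[of "x j"] by (simp add: algebra_simps)
    finally have "deficit A (rotate_coord w j x)
        \<le> deficit A x - 2 * Re ((w - 1) * x j * cnj (v j - x j)) - 2 * Re (w - 1)" by simp
    moreover have "- 2 * Re (w - 1) = (cmod (w - 1))\<^sup>2"
    proof -
      have "(Re w)\<^sup>2 + (Im w)\<^sup>2 = 1" using w cmod_power2[of w] by simp
      then show ?thesis unfolding cmod_power2 by (simp add: power2_eq_square algebra_simps)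
    qed
    moreover have "- Re ((w - 1) * x j * cnj (v j - x j)) \<le> cmod (w - 1) * p j"
      using abs_Re_le_cmod[of "(w - 1) * x j * cnj (v j - x j)"] x[of j]
      by (simp add: norm_mult p_def del: complex_cnj_diff)
    ultimately show ?thesis by (simp add: power2_eq_square algebra_simps)
  qed
  ultimately show ?thesis by (intro exI[of _ p]) (auto simp: p_def)
qed

lemma deficit_nonneg:
  fixes A :: "real^'n^'n"
  assumes "onorm (\<lambda>x. A *v x) \<le> 1" and "\<And>j. cmod (x j) = 1"
  shows "0 \<le> deficit A x"
proof -
  obtain p :: "'n \<Rightarrow> real" where "(\<Sum>j\<in>UNIV. (p j)\<^sup>2) \<le> deficit A x"
    using deficit_rotate_coord_le[where x = x, OF assms] by blast
  moreover have "0 \<le> (\<Sum>j\<in>UNIV. (p j)\<^sup>2)" by (simp add: sum_nonneg)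
  ultimately show ?thesis by linarith
qed

text \<open>The shift by \<open>1\<close> keeps the root away from \<open>0\<close>, where its slope
  would blow up, and leaves room for the second-order terms of a discrete step.\<close>

definition root_deficit :: "real^'n^'n \<Rightarrow> ('n \<Rightarrow> complex) \<Rightarrow> real" where
  "root_deficit A x = sqrt (deficit A x + 1)"

text \<open>A step changes the deficit by at most \<open>t * (2 * p j + t)\<close>, and the square
  root divides this by \<open>2 * sqrt (deficit A x + 1)\<close>. After squaring and summing, the
  squares of \<open>p\<close> are absorbed by the deficit and \<open>CARD('n) * t ^ 2\<close> by the
  shift \<open>1\<close>.\<close>

lemma root_deficit_gradient_le:
  fixes A :: "real^'n^'n"
  assumes A: "onorm (\<lambda>x. A *v x) \<le> 1" and x: "\<And>j. cmod (x j) = 1"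
    and w: "cmod w = 1" and small: "real CARD('n) * (cmod (w - 1))\<^sup>2 \<le> 1"
  shows "(\<Sum>j\<in>UNIV. (max 0 (root_deficit A (rotate_coord w j x) - root_deficit A x))\<^sup>2)
    \<le> 5 / 4 * (cmod (w - 1))\<^sup>2"
proof -
  define t where "t = cmod (w - 1)"
  let ?G = "deficit A" and ?g = "root_deficit A"
  obtain p where p: "\<And>j. 0 \<le> p j" "(\<Sum>j\<in>UNIV. (p j)\<^sup>2) \<le> ?G x"
    "\<And>j. ?G (rotate_coord w j x) \<le> ?G x + t * (2 * p j + t)"
    using deficit_rotate_coord_le[where x = x, OF A x] w unfolding t_def by blast
  have G0: "0 \<le> ?G x" by (rule deficit_nonneg[where x = x, OF A x])
  have t0: "0 \<le> t" by (simp add: t_def)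
  have g1: "(?g x)\<^sup>2 = ?G x + 1" "?g x \<ge> 1" using G0 by (auto simp: root_deficit_def)
  have "(max 0 (?g (rotate_coord w j x) - ?g x))\<^sup>2 \<le> t\<^sup>2 * (5 * ((p j)\<^sup>2 + t\<^sup>2)) / (4 * (?G x + 1))" for j
  proof (cases "?g (rotate_coord w j x) \<le> ?g x")
    case True
    then show ?thesis using G0 by simp
  next
    case False
    let ?h = "?g (rotate_coord w j x)"
    have G'0: "0 \<le> ?G (rotate_coord w j x)"
      by (rule deficit_nonneg[OF A]) (auto simp: rotate_coord_def norm_mult x w)
    \<comment> \<open>The right side is a difference of squares, that is, of deficits.\<close>
    have "(?h - ?g x) * (2 * ?g x) \<le> (?h - ?g x) * (?h + ?g x)"
      using False by (intro mult_left_mono) auto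
    also have "\<dots> = ?G (rotate_coord w j x) - ?G x"
      using G0 G'0 by (simp add: root_deficit_def algebra_simps)
    also have "\<dots> \<le> t * (2 * p j + t)" using p(3)[of j] by simp
    finally have "((?h - ?g x) * (2 * ?g x))\<^sup>2 \<le> (t * (2 * p j + t))\<^sup>2"
      using False g1(2) by (intro power_mono) auto
    also have "\<dots> \<le> t\<^sup>2 * (5 * ((p j)\<^sup>2 + t\<^sup>2))"
    proof -
      \<comment> \<open>Cauchy-Schwarz with the coefficient vector \<open>(2, 1)\<close>.\<close>
      have "(2 * p j + t)\<^sup>2 \<le> 5 * ((p j)\<^sup>2 + t\<^sup>2)"
        using zero_le_power2[of "p j - 2 * t"] by (simp add: power2_eq_square algebra_simps)
      then show ?thesis unfolding power_mult_distrib by (intro mult_left_mono) auto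
    qed
    finally have "(?h - ?g x)\<^sup>2 * (4 * (?G x + 1)) \<le> t\<^sup>2 * (5 * ((p j)\<^sup>2 + t\<^sup>2))"
      by (simp add: power_mult_distrib g1(1))
    then show ?thesis using False G0 by (simp add: pos_le_divide_eq)
  qed
  then have "(\<Sum>j\<in>UNIV. (max 0 (?g (rotate_coord w j x) - ?g x))\<^sup>2)
      \<le> (\<Sum>j\<in>UNIV. t\<^sup>2 * (5 * ((p j)\<^sup>2 + t\<^sup>2)) / (4 * (?G x + 1)))"
    by (intro sum_mono)
  also have "\<dots> = t\<^sup>2 * 5 * ((\<Sum>j\<in>UNIV. (p j)\<^sup>2) + real CARD('n) * t\<^sup>2) / (4 * (?G x + 1))"
    by (simp add: sum_divide_distrib[symmetric] sum_distrib_left[symmetric] sum.distrib)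
  also have "\<dots> \<le> t\<^sup>2 * 5 * (?G x + 1) / (4 * (?G x + 1))"
    using p(2) small G0 unfolding t_def by (intro divide_right_mono mult_left_mono add_mono) auto
  also have "\<dots> = 5 / 4 * t\<^sup>2" using G0 by (simp add: divide_simps)
  finally show ?thesis unfolding t_def .
qed

section \<open>Concentration of the deficit\<close>

text \<open>Multiply by \<open>exp t\<close>, bounded below by \<open>1 + t + t ^ 2 / 2\<close>: the
  product of the two quadratics is \<open>1 + t ^ 4 / 4\<close>.\<close>

lemma exp_minus_le_quadratic:
  fixes t :: real
  assumes "t \<ge> 0"
  shows "exp (- t) \<le> 1 - t + t\<^sup>2 / 2"
proof -
  have "1 \<le> (1 - t + t\<^sup>2 / 2) * (1 + t + t\<^sup>2 / 2)"
  proof -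
    have "(1 - t + t\<^sup>2 / 2) * (1 + t + t\<^sup>2 / 2) = 1 + (t\<^sup>2 / 2)\<^sup>2"
      by (simp add: power2_eq_square algebra_simps)
    then show ?thesis by simp
  qed
  also have "\<dots> \<le> (1 - t + t\<^sup>2 / 2) * exp t"
  proof (rule mult_left_mono[OF exp_lower_Taylor_quadratic[OF assms]])
    show "0 \<le> 1 - t + t\<^sup>2 / 2"
      using zero_le_power2[of "1 - t"] by (simp add: power2_eq_square algebra_simps)
  qed
  finally show ?thesis by (simp add: exp_minus field_simps)
qed

text \<open>Each halving of \<open>l\<close> squares the left-hand side, so the exponents accumulate a geometric series
  while the second-order remainder at scale \<open>l / 2 ^ N\<close> tends to \<open>0\<close>.\<close>

lemma avg_exp_le_by_halving:
  fixes g :: "'a \<Rightarrow> real"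
  assumes X: "finite X" "X \<noteq> {}" and g: "\<And>x. x \<in> X \<Longrightarrow> g x \<ge> 0"
    and var: "\<And>l. 0 < l \<Longrightarrow> l \<le> 1 / 10 \<Longrightarrow>
      avg X (\<lambda>x. exp (- l * g x)) - (avg X (\<lambda>x. exp (- (l / 2) * g x)))\<^sup>2
        \<le> 40 / 3 * l\<^sup>2 * avg X (\<lambda>x. exp (- l * g x))"
    and l: "0 < l" "l \<le> 1 / 10"
  shows "avg X (\<lambda>x. exp (- l * g x)) \<le> exp (- l * avg X g + 32 * l\<^sup>2)"
proof -
  define u where "u l = avg X (\<lambda>x. exp (- l * g x))" for l
  define M where "M = avg X (\<lambda>x. (g x)\<^sup>2) / 2"
  have M0: "M \<ge> 0" unfolding M_def by (simp add: avg_nonneg)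
  have u0: "u l \<ge> 0" for l unfolding u_def by (simp add: avg_nonneg)
  have step: "u l \<le> exp (- l * avg X g + 32 * l\<^sup>2 + l\<^sup>2 * M / 2 ^ N)" if "0 < l" "l \<le> 1 / 10" for l N
    using that
  proof (induction N arbitrary: l)
    case 0
    have "u l \<le> avg X (\<lambda>x. (1 - l * g x) + l\<^sup>2 / 2 * (g x)\<^sup>2)"
      unfolding u_def
    proof (intro avg_mono)
      fix x assume "x \<in> X"
      then show "exp (- l * g x) \<le> (1 - l * g x) + l\<^sup>2 / 2 * (g x)\<^sup>2"
        using exp_minus_le_quadratic[of "l * g x"] g 0 by (simp add: power_mult_distrib)
    qed
    also have "\<dots> = 1 + (- l * avg X g + l\<^sup>2 * M)"
      by (simp only: avg_add avg_diff avg_cmult avg_const[OF X] M_def)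
    also have "\<dots> \<le> exp (- l * avg X g + l\<^sup>2 * M)" by (rule exp_ge_add_one_self)
    also have "\<dots> \<le> exp (- l * avg X g + 32 * l\<^sup>2 + l\<^sup>2 * M / 2 ^ 0)" by simp
    finally show ?case .
  next
    case (Suc N)
    define s where "s = 40 / 3 * l\<^sup>2"
    have "l\<^sup>2 \<le> (1 / 10)\<^sup>2" using Suc.prems by (intro power_mono) auto
    then have s: "0 \<le> s" "s \<le> 2 / 15" by (auto simp: s_def power2_eq_square)
    \<comment> \<open>Valid for \<open>s\<close> up to \<open>1 / 6\<close>; the restriction
      \<open>l \<le> 1 / 10\<close> gives \<open>s \<le> 2 / 15\<close>. The resulting exponent
      \<open>6 / 5 * s\<close> is \<open>16 * l ^ 2\<close>.\<close>
    have "1 \<le> (1 - s) * (1 + 6 / 5 * s)"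
      using s mult_nonneg_nonneg[of s "1 / 6 - s"] by (simp add: algebra_simps)
    also have "\<dots> \<le> (1 - s) * exp (6 / 5 * s)"
      using s by (intro mult_left_mono exp_ge_add_one_self) auto
    finally have "u l \<le> u l * ((1 - s) * exp (6 / 5 * s))"
      using mult_left_mono[OF _ u0, of 1 "(1 - s) * exp (6 / 5 * s)" l] by simp
    also have "\<dots> = (u l - s * u l) * exp (16 * l\<^sup>2)"
      by (simp add: s_def algebra_simps)
    also have "\<dots> \<le> (u (l / 2))\<^sup>2 * exp (16 * l\<^sup>2)"
      using var[OF Suc.prems] by (intro mult_right_mono) (auto simp: u_def s_def)
    also have "\<dots> \<le> (exp (- (l / 2) * avg X g + 32 * (l / 2)\<^sup>2 + (l / 2)\<^sup>2 * M / 2 ^ N))\<^sup>2 * exp (16 * l\<^sup>2)"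
      using Suc.prems by (intro mult_right_mono power_mono Suc.IH u0) auto
    \<comment> \<open>Squaring turns \<open>32 * (l / 2) ^ 2\<close> into \<open>16 * l ^ 2\<close>,
      and the new factor supplies the other \<open>16 * l ^ 2\<close>; this fixed point determines
      the constant \<open>32\<close>.\<close>
    also have "\<dots> = exp (- l * avg X g + 32 * l\<^sup>2 + l\<^sup>2 * M / 2 ^ Suc N)"
      by (simp add: power2_eq_square flip: exp_add)
    finally show ?case .
  qed
  have "(\<lambda>N. exp (- l * avg X g + 32 * l\<^sup>2 + l\<^sup>2 * M * (1 / 2) ^ N))
      \<longlonglongrightarrow> exp (- l * avg X g + 32 * l\<^sup>2 + l\<^sup>2 * M * 0)"
    by (intro tendsto_intros LIMSEQ_realpow_zero) auto
  then show ?thesis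
    using step[OF l] unfolding u_def
    by (intro LIMSEQ_le_const) (auto simp: power_one_over field_simps)
qed

lemma cmod_cis_minus_one_le: "cmod (cis t - 1) \<le> \<bar>t\<bar>"
proof -
  have "cmod (cis t - 1) = 2 * \<bar>sin (t / 2)\<bar>"
    using dist_exp_i_1[of t] by (simp add: cis_conv_exp)
  also have "\<dots> \<le> \<bar>t\<bar>" using abs_sin_x_le_abs_x[of "t / 2"] by simp
  finally show ?thesis .
qed

text \<open>Increments of \<open>\<psi> \<circ> g\<close> along an edge are charged to the endpoint where \<open>g\<close> is
  smaller, because only upward increments of \<open>g\<close> are controlled.\<close>

lemma variance_root_deficit_le:
  fixes A :: "real^'n^'n" and \<psi> W :: "real \<Rightarrow> real"
  assumes A: "onorm (\<lambda>x. A *v x) \<le> 1" and m: "m = 8 * CARD('n)"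
    and W: "\<And>a. 0 \<le> W a" and \<psi>: "\<And>a b. a \<le> b \<Longrightarrow> (\<psi> b - \<psi> a)\<^sup>2 \<le> W a * (b - a)\<^sup>2"
  shows "avg (root_grid m) (\<lambda>x. (\<psi> (root_deficit A x))\<^sup>2)
      - (avg (root_grid m) (\<lambda>x. \<psi> (root_deficit A x)))\<^sup>2
    \<le> 160 / 3 * avg (root_grid m) (\<lambda>x. W (root_deficit A x))"
proof -
  let ?X = "root_grid m :: ('n \<Rightarrow> complex) set" and ?g = "root_deficit A"
  define w where "w = cis (2 * pi / real m)"
  define t where "t = cmod (w - 1)"
  have n1: "real CARD('n) \<ge> 1" by (simp add: Suc_leI)
  have m0: "m > 0" using m by simp
  have w1: "cmod w = 1" "w ^ m = 1" using m0 by (auto simp: w_def Complex.DeMoivre)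
  have cw: "cmod (cnj w) = 1" "cmod (cnj w - 1) = t"
    using w1 complex_mod_cnj[of "w - 1"] by (auto simp: t_def)
  have "t \<le> 2 * pi / real m" using cmod_cis_minus_one_le[of "2 * pi / real m"] by (simp add: w_def t_def)
  \<comment> \<open>With \<open>m = 8 * CARD('n)\<close> this gives
    \<open>t \<le> 1 / CARD('n)\<close>, small enough for the gradient bound, while
    \<open>m * t\<close> stays bounded and so absorbs the Poincare factor.\<close>
  also have "\<dots> \<le> 8 / real m" using pi_less_4 by (intro divide_right_mono) auto
  finally have tm: "t \<le> 8 / real m" .
  have t0: "t \<ge> 0" by (simp add: t_def)
  have mt: "(real m)\<^sup>2 * t\<^sup>2 \<le> 64"
  proof -
    have "real m * t \<le> 8" using tm m0 by (simp add: field_simps)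
    then have "(real m * t)\<^sup>2 \<le> 8\<^sup>2" using t0 by (intro power_mono) auto
    then show ?thesis by (simp add: power_mult_distrib)
  qed
  have small: "real CARD('n) * t\<^sup>2 \<le> 1"
  proof -
    have "t \<le> 1 / real CARD('n)" using tm by (simp add: m)
    then have "real CARD('n) * t \<le> 1" using n1 by (simp add: field_simps)
    moreover have "t \<le> real CARD('n) * t" using n1 t0 mult_right_mono[of 1 _ t] by simp
    ultimately have "(real CARD('n) * t) * t \<le> 1 * 1" using t0 by (intro mult_mono) auto
    then show ?thesis by (simp add: power2_eq_square)
  qed
  have xu: "cmod (x j) = 1" if "x \<in> ?X" for x j using cmod_root_grid[OF that m0] .
  define up where "up v j x = W (?g x) * (max 0 (?g (rotate_coord v j x) - ?g x))\<^sup>2" for v j x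
  have inv: "rotate_coord (cnj w) j (rotate_coord w j x) = x" for j x
  proof -
    have "cnj w * w = 1" using w1 complex_norm_square[of w] by (simp add: mult.commute)
    then show ?thesis by (simp add: rotate_coord_def mult.assoc[symmetric])
  qed
  have edge: "(\<psi> (?g (rotate_coord w j x)) - \<psi> (?g x))\<^sup>2 \<le> up w j x + up (cnj w) j (rotate_coord w j x)"
    for j x
  proof (cases "?g x \<le> ?g (rotate_coord w j x)")
    case True
    then have "(\<psi> (?g (rotate_coord w j x)) - \<psi> (?g x))\<^sup>2 \<le> up w j x"
      using \<psi>[OF True] by (simp add: up_def)
    moreover have "0 \<le> up (cnj w) j (rotate_coord w j x)" unfolding up_def by (simp add: W)
    ultimately show ?thesis by simp
  next
    case False
    then have "(\<psi> (?g (rotate_coord w j x)) - \<psi> (?g x))\<^sup>2 \<le> up (cnj w) j (rotate_coord w j x)"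
      using \<psi>[of "?g (rotate_coord w j x)" "?g x"] by (simp add: up_def inv power2_commute)
    moreover have "0 \<le> up w j x" unfolding up_def by (simp add: W)
    ultimately show ?thesis by simp
  qed
  have up_sum: "(\<Sum>j\<in>UNIV. avg ?X (up v j)) \<le> 5 / 4 * t\<^sup>2 * avg ?X (\<lambda>x. W (?g x))"
    if v: "cmod v = 1" "cmod (v - 1) = t" for v
  proof -
    have "(\<Sum>j\<in>UNIV. avg ?X (up v j)) = avg ?X (\<lambda>x. \<Sum>j\<in>UNIV. up v j x)"
      by (simp only: avg_sum)
    also have "\<dots> \<le> avg ?X (\<lambda>x. 5 / 4 * t\<^sup>2 * W (?g x))"
    proof (intro avg_mono)
      fix x assume x: "x \<in> ?X"
      have "(\<Sum>j\<in>UNIV. up v j x) = W (?g x) * (\<Sum>j\<in>UNIV. (max 0 (?g (rotate_coord v j x) - ?g x))\<^sup>2)"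
        by (simp add: up_def sum_distrib_left)
      also have "\<dots> \<le> W (?g x) * (5 / 4 * t\<^sup>2)"
        using root_deficit_gradient_le[where x = x, OF A xu[OF x] v(1)] small v(2)
        by (intro mult_left_mono W) auto
      finally show "(\<Sum>j\<in>UNIV. up v j x) \<le> 5 / 4 * t\<^sup>2 * W (?g x)" by (simp add: mult_ac)
    qed
    also have "\<dots> = 5 / 4 * t\<^sup>2 * avg ?X (\<lambda>x. W (?g x))" by (rule avg_cmult)
    finally show ?thesis .
  qed
  have "(\<Sum>j\<in>UNIV. avg ?X (\<lambda>x. (\<psi> (?g (rotate_coord w j x)) - \<psi> (?g x))\<^sup>2))
      \<le> (\<Sum>j\<in>UNIV. avg ?X (up w j) + avg ?X (up (cnj w) j))"
  proof (intro sum_mono)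
    fix j
    have "avg ?X (\<lambda>x. (\<psi> (?g (rotate_coord w j x)) - \<psi> (?g x))\<^sup>2)
        \<le> avg ?X (\<lambda>x. up w j x + up (cnj w) j (rotate_coord w j x))"
      by (intro avg_mono edge)
    \<comment> \<open>Rotation is a bijection of the grid, so charging to the far endpoint becomes
      an ordinary average for the reverse rotation.\<close>
    also have "\<dots> = avg ?X (up w j) + avg ?X (up (cnj w) j)"
      unfolding avg_add by (simp add: avg_bij[OF bij_betw_rotate_coord[OF w1(2) m0], of "up (cnj w) j"])
    finally show "avg ?X (\<lambda>x. (\<psi> (?g (rotate_coord w j x)) - \<psi> (?g x))\<^sup>2)
      \<le> avg ?X (up w j) + avg ?X (up (cnj w) j)" .
  qed
  also have "\<dots> \<le> 5 / 2 * t\<^sup>2 * avg ?X (\<lambda>x. W (?g x))"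
    using up_sum[OF w1(1) t_def[symmetric]] up_sum[OF cw] by (simp add: sum.distrib)
  finally have "(\<Sum>j\<in>UNIV. avg ?X (\<lambda>x. (\<psi> (?g (rotate_coord w j x)) - \<psi> (?g x))\<^sup>2))
    \<le> 5 / 2 * t\<^sup>2 * avg ?X (\<lambda>x. W (?g x))" .
  then have "avg ?X (\<lambda>x. (\<psi> (?g x))\<^sup>2) - (avg ?X (\<lambda>x. \<psi> (?g x)))\<^sup>2
      \<le> (real m)\<^sup>2 / 3 * (5 / 2 * t\<^sup>2 * avg ?X (\<lambda>x. W (?g x)))"
    using poincare_root_grid[OF m0, of "\<lambda>x. \<psi> (?g x)"] unfolding w_def
    by (elim order_trans) (intro mult_left_mono, auto)
  also have "\<dots> = ((real m)\<^sup>2 * t\<^sup>2) * (5 / 6 * avg ?X (\<lambda>x. W (?g x)))" by simp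
  also have "\<dots> \<le> 64 * (5 / 6 * avg ?X (\<lambda>x. W (?g x)))"
    by (intro mult_right_mono mt mult_nonneg_nonneg avg_nonneg W) auto
  finally show ?thesis by simp
qed

text \<open>The variance bound is used twice: with the identity it bounds the mean of
  \<open>root_deficit\<close> below by the mean deficit, and with exponentials it supplies the
  hypothesis of the halving argument at scale \<open>1 / 10\<close>.\<close>

theorem perm_le_exp_avg_deficit:
  fixes A :: "real^'n^'n"
  assumes A: "onorm (\<lambda>x. A *v x) \<le> 1" and m: "m = 8 * CARD('n)"
  shows "\<bar>perm A\<bar> \<le> exp (1 - sqrt (avg (root_grid m) (deficit A) - 53) / 10)"
proof -
  let ?X = "root_grid m :: ('n \<Rightarrow> complex) set" and ?g = "root_deficit A"
  have m0: "m > 0" and m1: "m > 1" using m by (auto simp: Suc_lessI)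
  note X = finite_root_grid[OF m0, where 'n = 'n] root_grid_nonempty
  have G0: "deficit A x \<ge> 0" if "x \<in> ?X" for x
    using deficit_nonneg[where x = x, OF A cmod_root_grid[OF that m0]] .
  have g0: "?g x \<ge> 0" "(?g x)\<^sup>2 = deficit A x + 1" if "x \<in> ?X" for x
    using G0[OF that] by (auto simp: root_deficit_def)
  have Eg0: "avg ?X ?g \<ge> 0" using g0 by (intro avg_nonneg)
  have "avg ?X (\<lambda>x. (?g x)\<^sup>2) - (avg ?X ?g)\<^sup>2 \<le> 160 / 3"
    using variance_root_deficit_le[OF A m, of "\<lambda>_. 1" "\<lambda>a. a"] by (simp add: avg_const[OF X])
  moreover have "avg ?X (\<lambda>x. (?g x)\<^sup>2) = avg ?X (\<lambda>x. deficit A x + 1)"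
    by (intro avg_cong g0)
  \<comment> \<open>The variance constant less the shift, \<open>160 / 3 - 1\<close>, is below
    \<open>53\<close>.\<close>
  ultimately have "avg ?X (deficit A) - 53 \<le> (avg ?X ?g)\<^sup>2"
    by (simp add: avg_add avg_const[OF X])
  \<comment> \<open>A negative radicand does no harm, since \<open>sqrt\<close> is monotone on all
    reals.\<close>
  then have Eg: "sqrt (avg ?X (deficit A) - 53) \<le> avg ?X ?g"
    using real_sqrt_le_mono Eg0 by fastforce
  have conc: "avg ?X (\<lambda>x. exp (- (1 / 10) * ?g x)) \<le> exp (- (1 / 10) * avg ?X ?g + 32 * (1 / 10)\<^sup>2)"
  proof (rule avg_exp_le_by_halving[OF X g0(1)])
    fix l :: real assume l: "0 < l" "l \<le> 1 / 10"
    \<comment> \<open>\<open>?W\<close> is the squared derivative of \<open>?\<psi>\<close>, largest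
      at the left endpoint as \<open>?\<psi>\<close> is convex and decreasing. Its factor
      \<open>1 / 4\<close> turns \<open>160 / 3\<close> into \<open>40 / 3\<close>.\<close>
    let ?\<psi> = "\<lambda>a. exp (- (l / 2) * a)" and ?W = "\<lambda>a. l\<^sup>2 / 4 * exp (- l * a)"
    have "(?\<psi> b - ?\<psi> a)\<^sup>2 \<le> ?W a * (b - a)\<^sup>2" if "a \<le> b" for a b
    proof -
      define s where "s = l / 2 * (b - a)"
      have s: "s \<ge> 0" using that l by (simp add: s_def)
      have "0 \<le> 1 - exp (- s)" "1 - exp (- s) \<le> s"
        using s exp_ge_add_one_self[of "- s"] by auto
      then have "(1 - exp (- s))\<^sup>2 \<le> s\<^sup>2" by (intro power_mono)
      then have "(?\<psi> a)\<^sup>2 * (1 - exp (- s))\<^sup>2 \<le> (?\<psi> a)\<^sup>2 * s\<^sup>2" by (intro mult_left_mono) auto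
      moreover have "?\<psi> b = ?\<psi> a * exp (- s)"
        by (simp add: s_def flip: exp_add) (simp add: field_simps)
      then have "(?\<psi> b - ?\<psi> a)\<^sup>2 = (?\<psi> a)\<^sup>2 * (1 - exp (- s))\<^sup>2"
        by (simp add: power2_eq_square algebra_simps)
      moreover have "(?\<psi> a)\<^sup>2 = exp (- l * a)"
        by (simp add: power2_eq_square flip: exp_add)
      ultimately show ?thesis by (simp add: s_def power_mult_distrib power_divide mult_ac)
    qed
    from variance_root_deficit_le[OF A m _ this]
    have "avg ?X (\<lambda>x. (?\<psi> (?g x))\<^sup>2) - (avg ?X (\<lambda>x. ?\<psi> (?g x)))\<^sup>2 \<le> 160 / 3 * avg ?X (\<lambda>x. ?W (?g x))"
      by simp
    moreover have "(?\<psi> a)\<^sup>2 = exp (- l * a)" for a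
      by (simp add: power2_eq_square flip: exp_add)
    ultimately show "avg ?X (\<lambda>x. exp (- l * ?g x)) - (avg ?X (\<lambda>x. exp (- (l / 2) * ?g x)))\<^sup>2
        \<le> 40 / 3 * l\<^sup>2 * avg ?X (\<lambda>x. exp (- l * ?g x))"
      by (simp only: avg_cmult)
  qed auto
  have "\<bar>perm A\<bar> \<le> avg ?X (\<lambda>x. exp (\<Sum>i\<in>UNIV. cmod (row_form A x i) - 1))"
    by (rule perm_le_avg_exp[OF m1])
  also have "\<dots> \<le> avg ?X (\<lambda>x. exp (101 / 200) * exp (- (1 / 10) * ?g x))"
  proof (intro avg_mono)
    fix x assume x: "x \<in> ?X"
    have "(\<Sum>i\<in>UNIV. cmod (row_form A x i) - 1) = - deficit A x / 2"
      by (simp add: deficit_def sum_subtractf)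
    also have "\<dots> = (1 - (?g x)\<^sup>2) / 2" using g0(2)[OF x] by simp
    \<comment> \<open>The concave parabola lies below its tangent of slope \<open>- 1 / 10\<close>,
      taken at \<open>1 / 10\<close>.\<close>
    also have "\<dots> \<le> 101 / 200 + (- (1 / 10) * ?g x)"
      using zero_le_power2[of "?g x - 1 / 10"] by (simp add: power2_eq_square field_simps)
    finally show "exp (\<Sum>i\<in>UNIV. cmod (row_form A x i) - 1) \<le> exp (101 / 200) * exp (- (1 / 10) * ?g x)"
      by (simp flip: exp_add)
  qed
  also have "\<dots> \<le> exp (101 / 200) * exp (- (1 / 10) * avg ?X ?g + 32 * (1 / 10)\<^sup>2)"
    unfolding avg_cmult by (intro mult_left_mono conc) simp
  \<comment> \<open>The constants \<open>101 / 200\<close> and \<open>32 / 100\<close> add up to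
    less than \<open>1\<close>.\<close>
  also have "\<dots> \<le> exp (1 - sqrt (avg ?X (deficit A) - 53) / 10)"
    using Eg by (simp add: power2_eq_square flip: exp_add)
  finally show ?thesis .
qed

section \<open>The mean of the deficit\<close>

text \<open>\<open>\<alpha>\<close> and \<open>\<beta>\<close> are the real and imaginary parts of
  \<open>a * cnj b\<close>. Over the four turns the cross terms occur with both signs, so they
  cancel in the second moment and leave only the sum of their squares in the fourth.\<close>

lemma quarter_turns:
  fixes a b :: complex
  defines "Q \<equiv> \<lambda>k. (cmod (a + \<i> ^ k * b))\<^sup>2"
  obtains \<alpha> \<beta> where "\<alpha>\<^sup>2 + \<beta>\<^sup>2 = (cmod a)\<^sup>2 * (cmod b)\<^sup>2"
    "Q 0 = (cmod a)\<^sup>2 + (cmod b)\<^sup>2 + 2 * \<alpha>" "Q 1 = (cmod a)\<^sup>2 + (cmod b)\<^sup>2 + 2 * \<beta>"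
    "Q 2 = (cmod a)\<^sup>2 + (cmod b)\<^sup>2 - 2 * \<alpha>" "Q 3 = (cmod a)\<^sup>2 + (cmod b)\<^sup>2 - 2 * \<beta>"
proof
  let ?\<alpha> = "Re a * Re b + Im a * Im b" and ?\<beta> = "Im a * Re b - Re a * Im b"
  show "?\<alpha>\<^sup>2 + ?\<beta>\<^sup>2 = (cmod a)\<^sup>2 * (cmod b)\<^sup>2"
    unfolding cmod_power2 by (simp add: power2_eq_square algebra_simps)
  show "Q 0 = (cmod a)\<^sup>2 + (cmod b)\<^sup>2 + 2 * ?\<alpha>" "Q 1 = (cmod a)\<^sup>2 + (cmod b)\<^sup>2 + 2 * ?\<beta>"
    "Q 2 = (cmod a)\<^sup>2 + (cmod b)\<^sup>2 - 2 * ?\<alpha>"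
    unfolding Q_def cmod_power2 by (simp_all add: power2_eq_square algebra_simps)
  show "Q 3 = (cmod a)\<^sup>2 + (cmod b)\<^sup>2 - 2 * ?\<beta>"
    unfolding Q_def cmod_power2 by (simp add: power2_eq_square power3_eq_cube algebra_simps)
qed

lemma sum_lessThan_4: "(\<Sum>k<4. f k) = f 0 + f 1 + f 2 + (f 3 :: real)" for f :: "nat \<Rightarrow> real"
  by (simp add: eval_nat_numeral)

lemma quarter_turns_second_moment:
  "(\<Sum>k<4. (cmod (a + \<i> ^ k * b))\<^sup>2) / 4 = (cmod a)\<^sup>2 + (cmod b)\<^sup>2"
  by (rule quarter_turns[of a b]) (simp only: sum_lessThan_4, simp)

lemma quarter_turns_fourth_moment:
  "(\<Sum>k<4. (cmod (a + \<i> ^ k * b))^4) / 4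
    = ((cmod a)\<^sup>2 + (cmod b)\<^sup>2)\<^sup>2 + 2 * (cmod a)\<^sup>2 * (cmod b)\<^sup>2"
proof -
  have 4: "(c :: real) ^ 4 = (c\<^sup>2)\<^sup>2" for c by simp
  obtain \<alpha> \<beta> where ab: "\<alpha>\<^sup>2 + \<beta>\<^sup>2 = (cmod a)\<^sup>2 * (cmod b)\<^sup>2" and
    Q: "(cmod (a + \<i> ^ 0 * b))\<^sup>2 = (cmod a)\<^sup>2 + (cmod b)\<^sup>2 + 2 * \<alpha>"
    "(cmod (a + \<i> ^ 1 * b))\<^sup>2 = (cmod a)\<^sup>2 + (cmod b)\<^sup>2 + 2 * \<beta>"
    "(cmod (a + \<i> ^ 2 * b))\<^sup>2 = (cmod a)\<^sup>2 + (cmod b)\<^sup>2 - 2 * \<alpha>"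
    "(cmod (a + \<i> ^ 3 * b))\<^sup>2 = (cmod a)\<^sup>2 + (cmod b)\<^sup>2 - 2 * \<beta>"
    by (rule quarter_turns[of a b])
  define P where "P = (cmod a)\<^sup>2 + (cmod b)\<^sup>2"
  have "(\<Sum>k<4. (cmod (a + \<i> ^ k * b))^4) / 4 = P\<^sup>2 + 2 * (\<alpha>\<^sup>2 + \<beta>\<^sup>2)"
    unfolding 4 sum_lessThan_4 Q P_def[symmetric] by (simp add: power2_eq_square algebra_simps)
  then show ?thesis unfolding ab P_def by simp
qed

text \<open>Write \<open>c - 1\<close> as \<open>(c ^ 2 - 1) / (c + 1)\<close>. The denominator
  squared is at most \<open>2 + 4 * P\<close>, and the mean square of \<open>c ^ 2 - 1\<close> is at
  least the variance of \<open>c ^ 2\<close> over the four turns, which is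
  \<open>2 * (cmod a) ^ 2 * (cmod b) ^ 2\<close>.\<close>

lemma quarter_turns_dist_one:
  "(cmod a)\<^sup>2 * (cmod b)\<^sup>2 / (1 + 2 * ((cmod a)\<^sup>2 + (cmod b)\<^sup>2))
    \<le> (\<Sum>k<4. (cmod (a + \<i> ^ k * b) - 1)\<^sup>2) / 4"
proof -
  define P where "P = (cmod a)\<^sup>2 + (cmod b)\<^sup>2"
  define Q where "Q k = (cmod (a + \<i> ^ k * b))\<^sup>2" for k
  have P0: "P \<ge> 0" by (simp add: P_def)
  have 4: "(c :: real) ^ 4 = (c\<^sup>2)\<^sup>2" for c by simp
  have "(Q k - 1)\<^sup>2 / (2 + 4 * P) \<le> (cmod (a + \<i> ^ k * b) - 1)\<^sup>2" for k
  proof -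
    define c where "c = cmod (a + \<i> ^ k * b)"
    have "c \<le> cmod a + cmod b"
      unfolding c_def using norm_triangle_ineq[of a "\<i> ^ k * b"] by (simp add: norm_mult norm_power)
    then have "c\<^sup>2 \<le> (cmod a + cmod b)\<^sup>2" by (intro power_mono) (auto simp: c_def)
    also have "\<dots> \<le> 2 * P"
      using zero_le_power2[of "cmod a - cmod b"] unfolding P_def
      by (simp add: power2_eq_square algebra_simps)
    finally have "(c + 1)\<^sup>2 \<le> 2 + 4 * P"
      using zero_le_power2[of "c - 1"] by (simp add: power2_eq_square algebra_simps)
    then have "(c - 1)\<^sup>2 * (c + 1)\<^sup>2 \<le> (c - 1)\<^sup>2 * (2 + 4 * P)" by (intro mult_left_mono) auto
    moreover have "(c - 1)\<^sup>2 * (c + 1)\<^sup>2 = (Q k - 1)\<^sup>2"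
      unfolding Q_def c_def[symmetric] by (simp add: power2_eq_square algebra_simps)
    ultimately show ?thesis using P0 unfolding c_def by (simp add: field_simps)
  qed
  then have "(\<Sum>k<4. (Q k - 1)\<^sup>2 / (2 + 4 * P)) \<le> (\<Sum>k<4. (cmod (a + \<i> ^ k * b) - 1)\<^sup>2)"
    by (intro sum_mono)
  moreover have "(\<Sum>k<4. (Q k - 1)\<^sup>2) = 4 * ((P - 1)\<^sup>2 + 2 * (cmod a)\<^sup>2 * (cmod b)\<^sup>2)"
  proof -
    have "(\<Sum>k<4. (Q k - 1)\<^sup>2) = (\<Sum>k<4. (cmod (a + \<i> ^ k * b))^4) - 2 * (\<Sum>k<4. (cmod (a + \<i> ^ k * b))\<^sup>2) + 4"
      unfolding 4 Q_def by (simp add: power2_diff sum.distrib sum_subtractf sum_distrib_left)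
    then show ?thesis
      using quarter_turns_second_moment[of a b] quarter_turns_fourth_moment[of a b]
      unfolding P_def by (simp add: power2_diff)
  qed
  ultimately have "4 * ((P - 1)\<^sup>2 + 2 * (cmod a)\<^sup>2 * (cmod b)\<^sup>2) / (2 + 4 * P)
      \<le> (\<Sum>k<4. (cmod (a + \<i> ^ k * b) - 1)\<^sup>2)"
    by (simp only: sum_divide_distrib[symmetric])
  then have "4 * ((P - 1)\<^sup>2 + 2 * (cmod a)\<^sup>2 * (cmod b)\<^sup>2) / (2 + 4 * P) / 4
      \<le> (\<Sum>k<4. (cmod (a + \<i> ^ k * b) - 1)\<^sup>2) / 4"
    by (intro divide_right_mono) auto
  moreover have "(cmod a)\<^sup>2 * (cmod b)\<^sup>2 / (1 + 2 * P)
      = 4 * (2 * (cmod a)\<^sup>2 * (cmod b)\<^sup>2) / (2 + 4 * P) / 4"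
    using P0 by (simp add: divide_simps)
  moreover have "4 * (2 * (cmod a)\<^sup>2 * (cmod b)\<^sup>2) / (2 + 4 * P) / 4
      \<le> 4 * ((P - 1)\<^sup>2 + 2 * (cmod a)\<^sup>2 * (cmod b)\<^sup>2) / (2 + 4 * P) / 4"
    using P0 by (intro divide_right_mono mult_left_mono) auto
  ultimately show ?thesis unfolding P_def[symmetric] by linarith
qed

section \<open>Quarter turns of coordinates and moments of linear forms\<close>

definition quarter_turn :: "'n set \<Rightarrow> nat \<Rightarrow> ('n \<Rightarrow> complex) \<Rightarrow> 'n \<Rightarrow> complex" where
  "quarter_turn S k x = (\<lambda>j. (if j \<in> S then \<i> ^ k else 1) * x j)"

lemma avg_quarter_turns:
  assumes m: "m > 0" "4 dvd m"
  shows "avg (root_grid m) f = avg (root_grid m) (\<lambda>x. (\<Sum>k<4. f (quarter_turn S k x)) / 4)"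
proof -
  have "(\<i> ^ k) ^ m = 1" for k
  proof -
    obtain d where "m = 4 * d" using m(2) by blast
    then have "(\<i> ^ k) ^ m = ((\<i> ^ 4) ^ d) ^ k" by (simp only: power_mult[symmetric] mult_ac)
    then show ?thesis by simp
  qed
  then have "(\<lambda>j. if j \<in> S then \<i> ^ k else 1) \<in> root_grid m" for k by (simp add: root_grid_def)
  from avg_bij[OF bij_betw_root_grid_mult[OF this m(1)], of f]
  have "avg (root_grid m) (\<lambda>x. f (quarter_turn S k x)) = avg (root_grid m) f" for k
    unfolding quarter_turn_def .
  then show ?thesis by (simp add: avg_cdiv avg_sum)
qed

definition lin_form :: "('n \<Rightarrow> real) \<Rightarrow> 'n set \<Rightarrow> ('n \<Rightarrow> complex) \<Rightarrow> complex" where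
  "lin_form r S x = (\<Sum>j\<in>S. of_real (r j) * x j)"

lemma lin_form_quarter_turn: "lin_form r S (quarter_turn S k x) = \<i> ^ k * lin_form r S x"
  unfolding lin_form_def quarter_turn_def by (simp add: sum_distrib_left mult_ac)

lemma lin_form_quarter_turn_disjoint:
  "S \<inter> S' = {} \<Longrightarrow> lin_form r S (quarter_turn S' k x) = lin_form r S x"
  unfolding lin_form_def quarter_turn_def by (intro sum.cong) auto

text \<open>Add one coordinate at a time and average over its quarter turns. The weight
  \<open>W\<close> stands in for independence: it may be any power of the modulus of a form on the
  complementary coordinates.\<close>

lemma lin_form_moments:
  fixes r :: "'n::finite \<Rightarrow> real" and W :: "('n \<Rightarrow> complex) \<Rightarrow> real"
  assumes m: "m > 0" "4 dvd m"
    and W0: "\<And>x. 0 \<le> W x" and W: "\<And>j k x. j \<in> S \<Longrightarrow> W (quarter_turn {j} k x) = W x"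
  shows "avg (root_grid m) (\<lambda>x. W x * (cmod (lin_form r S x))\<^sup>2)
      = (\<Sum>j\<in>S. (r j)\<^sup>2) * avg (root_grid m) W" (is ?second)
    and "avg (root_grid m) (\<lambda>x. W x * (cmod (lin_form r S x))^4)
      \<le> 2 * (\<Sum>j\<in>S. (r j)\<^sup>2)\<^sup>2 * avg (root_grid m) W" (is ?fourth)
proof -
  have "finite S" by simp
  then have "?second \<and> ?fourth" using W
  proof (induction S rule: finite_induct)
    case empty
    then show ?case by (simp add: lin_form_def avg_def)
  next
    case (insert j S)
    let ?X = "root_grid m :: ('n \<Rightarrow> complex) set"
    let ?L = "lin_form r S" and ?s = "\<Sum>j\<in>S. (r j)\<^sup>2"
    have IH: "avg ?X (\<lambda>x. W x * (cmod (?L x))\<^sup>2) = ?s * avg ?X W"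
      "avg ?X (\<lambda>x. W x * (cmod (?L x))^4) \<le> 2 * ?s\<^sup>2 * avg ?X W"
      using insert.IH insert.prems by auto
    have turn: "W (quarter_turn {j} k x) * cmod (lin_form r (insert j S) (quarter_turn {j} k x)) ^ d
        = W x * cmod (?L x + \<i> ^ k * (of_real (r j) * x j)) ^ d" for k d x
    proof -
      have "lin_form r (insert j S) (quarter_turn {j} k x)
          = of_real (r j) * (\<i> ^ k * x j) + lin_form r S (quarter_turn {j} k x)"
        using insert.hyps by (simp add: lin_form_def quarter_turn_def)
      also have "\<dots> = ?L x + \<i> ^ k * (of_real (r j) * x j)"
        using insert.hyps lin_form_quarter_turn_disjoint[of S "{j}" r k x] by simp
      finally show ?thesis using insert.prems by simp
    qed
    have mod: "(cmod (of_real (r j) * x j))\<^sup>2 = (r j)\<^sup>2" if "x \<in> ?X" for x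
      using cmod_root_grid[OF that m(1)] by (simp add: norm_mult)
    have "avg ?X (\<lambda>x. W x * (cmod (lin_form r (insert j S) x))\<^sup>2)
        = avg ?X (\<lambda>x. W x * ((\<Sum>k<4. (cmod (?L x + \<i> ^ k * (of_real (r j) * x j)))\<^sup>2) / 4))"
      by (subst avg_quarter_turns[OF m, of _ "{j}"]) (simp only: turn sum_distrib_left[symmetric] times_divide_eq_right)
    also have "\<dots> = avg ?X (\<lambda>x. W x * (cmod (?L x))\<^sup>2 + (r j)\<^sup>2 * W x)"
      unfolding quarter_turns_second_moment by (intro avg_cong) (simp only: mod, simp add: algebra_simps)
    also have "\<dots> = (?s + (r j)\<^sup>2) * avg ?X W"
      unfolding avg_add avg_cmult IH by (simp add: algebra_simps)
    finally have second: "avg ?X (\<lambda>x. W x * (cmod (lin_form r (insert j S) x))\<^sup>2)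
        = (\<Sum>j\<in>insert j S. (r j)\<^sup>2) * avg ?X W"
      using insert.hyps by (simp add: add.commute)
    have "avg ?X (\<lambda>x. W x * (cmod (lin_form r (insert j S) x))^4)
        = avg ?X (\<lambda>x. W x * ((\<Sum>k<4. (cmod (?L x + \<i> ^ k * (of_real (r j) * x j)))^4) / 4))"
      by (subst avg_quarter_turns[OF m, of _ "{j}"]) (simp only: turn sum_distrib_left[symmetric] times_divide_eq_right)
    also have "\<dots> = avg ?X (\<lambda>x. (W x * (cmod (?L x))^4 + 4 * (r j)\<^sup>2 * (W x * (cmod (?L x))\<^sup>2)) + (r j)^4 * W x)"
      unfolding quarter_turns_fourth_moment
      by (intro avg_cong) (simp only: mod, simp add: power2_eq_square power4_eq_xxxx algebra_simps)
    also have "\<dots> = avg ?X (\<lambda>x. W x * (cmod (?L x))^4) + (4 * (r j)\<^sup>2 * ?s + (r j)^4) * avg ?X W"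
      unfolding avg_add avg_cmult IH(1) by (simp add: algebra_simps)
    also have "\<dots> \<le> (2 * ?s\<^sup>2 + 4 * (r j)\<^sup>2 * ?s + (r j)^4) * avg ?X W"
      using IH(2) by (simp add: algebra_simps)
    also have "\<dots> \<le> 2 * ((r j)\<^sup>2 + ?s)\<^sup>2 * avg ?X W"
    proof (intro mult_right_mono avg_nonneg W0)
      show "2 * ?s\<^sup>2 + 4 * (r j)\<^sup>2 * ?s + (r j)^4 \<le> 2 * ((r j)\<^sup>2 + ?s)\<^sup>2"
        using zero_le_power2[of "(r j)\<^sup>2"]
        by (simp add: power2_eq_square power4_eq_xxxx algebra_simps)
    qed
    finally show ?case using second insert.hyps by simp
  qed
  then show ?second ?fourth by auto
qed

text \<open>Greedy choice: each new element goes to the lighter side, so the imbalance never exceeds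
  \<open>b\<close>.\<close>

lemma balanced_split:
  fixes c :: "'a \<Rightarrow> real"
  assumes "finite I" "\<And>i. i \<in> I \<Longrightarrow> 0 \<le> c i \<and> c i \<le> b" "0 \<le> b"
  shows "\<exists>S\<subseteq>I. \<bar>sum c I - 2 * sum c S\<bar> \<le> b"
  using assms
proof (induction I rule: finite_induct)
  case (insert i I)
  then obtain S where S: "S \<subseteq> I" "\<bar>sum c I - 2 * sum c S\<bar> \<le> b" by auto
  have fin: "finite S" "i \<notin> S" using S insert.hyps finite_subset by auto
  have ci: "0 \<le> c i" "c i \<le> b" using insert.prems by auto
  show ?case
  proof (cases "sum c I - 2 * sum c S \<ge> 0")
    case True
    then have "\<bar>sum c (insert i I) - 2 * sum c (insert i S)\<bar> \<le> b"
      using S(2) ci fin insert.hyps by simp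
    then show ?thesis using S(1) by blast
  next
    case False
    then have "\<bar>sum c (insert i I) - 2 * sum c S\<bar> \<le> b"
      using S(2) ci fin insert.hyps by simp
    then show ?thesis using S(1) by blast
  qed
qed simp

text \<open>Turning only the part \<open>u\<close> reduces the claim to the mean of
  \<open>v ^ 2 / P\<close>, with \<open>v\<close> the product of the two moduli. This quotient is
  replaced by a lower bound linear in \<open>v\<close> and \<open>P\<close>. The mean of
  \<open>v\<close> is bounded below from its second and fourth moments.\<close>

lemma avg_cmod_lin_form_dist_one:
  fixes r :: "'n::finite \<Rightarrow> real"
  assumes m: "m > 0" "4 dvd m" and r: "(\<Sum>j\<in>UNIV. (r j)\<^sup>2) \<le> 1"
  shows "(\<Sum>j\<in>S. (r j)\<^sup>2) * (\<Sum>j\<in>-S. (r j)\<^sup>2) / 12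
    \<le> avg (root_grid m) (\<lambda>x. (cmod (lin_form r UNIV x) - 1)\<^sup>2)"
proof -
  let ?X = "root_grid m :: ('n \<Rightarrow> complex) set"
  define u where "u = lin_form r S"
  define z where "z = lin_form r (-S)"
  define \<alpha> where "\<alpha> = (\<Sum>j\<in>S. (r j)\<^sup>2)"
  define \<beta> where "\<beta> = (\<Sum>j\<in>-S. (r j)\<^sup>2)"
  note X = finite_root_grid[OF m(1), where 'n = 'n] root_grid_nonempty
  have \<alpha>\<beta>: "\<alpha> \<ge> 0" "\<beta> \<ge> 0" "\<alpha> + \<beta> \<le> 1"
  proof -
    have "\<alpha> + \<beta> = (\<Sum>j\<in>S \<union> -S. (r j)\<^sup>2)" unfolding \<alpha>_def \<beta>_def by (rule sum.union_disjoint[symmetric]) auto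
    then show "\<alpha> + \<beta> \<le> 1" using r by (simp add: Compl_partition)
  qed (auto simp: \<alpha>_def \<beta>_def sum_nonneg)
  show ?thesis
  proof (cases "\<alpha> * \<beta> = 0")
    case True
    have "0 \<le> avg ?X (\<lambda>x. (cmod (lin_form r UNIV x) - 1)\<^sup>2)" by (intro avg_nonneg) simp
    then show ?thesis using True by (simp only: \<alpha>_def \<beta>_def)
  next
    case False
    define s where "s = sqrt (\<alpha> * \<beta>)"
    have s: "s > 0" "s\<^sup>2 = \<alpha> * \<beta>" using False \<alpha>\<beta> by (auto simp: s_def less_le)
    define v where "v x = cmod (u x) * cmod (z x)" for x
    have zW: "cmod (z (quarter_turn {j} k x)) = cmod (z x)" if "j \<in> S" for j k x
      using that lin_form_quarter_turn_disjoint[of "-S" "{j}" r k x] by (simp add: z_def)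
    have Ez2: "avg ?X (\<lambda>x. (cmod (z x))\<^sup>2) = \<beta>"
      using lin_form_moments(1)[OF m, of "\<lambda>_. 1" "-S" r] by (simp add: z_def \<beta>_def avg_const[OF X])
    have Ez4: "avg ?X (\<lambda>x. (cmod (z x))^4) \<le> 2 * \<beta>\<^sup>2"
      using lin_form_moments(2)[OF m, of "\<lambda>_. 1" "-S" r] by (simp add: z_def \<beta>_def avg_const[OF X])
    have Eu2: "avg ?X (\<lambda>x. (cmod (u x))\<^sup>2) = \<alpha>"
      using lin_form_moments(1)[OF m, of "\<lambda>_. 1" S r] by (simp add: u_def \<alpha>_def avg_const[OF X])
    have Ev2: "avg ?X (\<lambda>x. (v x)\<^sup>2) = s\<^sup>2"
      using lin_form_moments(1)[OF m, of "\<lambda>x. (cmod (z x))\<^sup>2" S r] zW Ez2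
      by (simp add: s(2) v_def u_def \<alpha>_def power_mult_distrib mult.commute)
    have Ev4: "avg ?X (\<lambda>x. (v x)^4) \<le> 4 * s^4"
    proof -
      have "avg ?X (\<lambda>x. (v x)^4) \<le> 2 * \<alpha>\<^sup>2 * avg ?X (\<lambda>x. (cmod (z x))^4)"
        using lin_form_moments(2)[OF m, of "\<lambda>x. (cmod (z x))^4" S r] zW
        by (simp add: v_def u_def \<alpha>_def power_mult_distrib mult.commute)
      also have "\<dots> \<le> 2 * \<alpha>\<^sup>2 * (2 * \<beta>\<^sup>2)" by (intro mult_left_mono Ez4) auto
      also have "\<dots> = 4 * (s\<^sup>2)\<^sup>2" by (simp add: s(2) power_mult_distrib)
      finally show ?thesis by simp
    qed
    have Ev: "s / 2 \<le> avg ?X v"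
    proof -
      \<comment> \<open>The minorant meets \<open>v\<close> at \<open>0\<close> and touches it at
        \<open>2 * s\<close>: these are the values of the extremal two-point distribution with
        second moment \<open>s ^ 2\<close> and fourth moment \<open>4 * s ^ 4\<close>, whose mean is
        \<open>s / 2\<close>.\<close>
      have "3 / (4 * s) * (v x)\<^sup>2 - 1 / (16 * s^3) * (v x)^4 \<le> v x" for x
      proof -
        have v0: "v x \<ge> 0" by (simp add: v_def)
        have "0 \<le> v x * (v x - 2 * s)\<^sup>2 * (v x + 4 * s)" using v0 s by simp
        also have "\<dots> = 16 * s^3 * (v x - (3 / (4 * s) * (v x)\<^sup>2 - 1 / (16 * s^3) * (v x)^4))"
          using s(1) by (simp add: power2_eq_square power3_eq_cube power4_eq_xxxx field_simps)
        finally show ?thesis using s by (simp add: zero_le_mult_iff)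
      qed
      then have "avg ?X (\<lambda>x. 3 / (4 * s) * (v x)\<^sup>2 - 1 / (16 * s^3) * (v x)^4) \<le> avg ?X v"
        by (intro avg_mono)
      moreover have "avg ?X (\<lambda>x. 3 / (4 * s) * (v x)\<^sup>2 - 1 / (16 * s^3) * (v x)^4)
          = 3 / (4 * s) * s\<^sup>2 - 1 / (16 * s^3) * avg ?X (\<lambda>x. (v x)^4)"
        unfolding avg_diff avg_cmult Ev2 ..
      moreover have "1 / (16 * s^3) * avg ?X (\<lambda>x. (v x)^4) \<le> 1 / (16 * s^3) * (4 * s^4)"
        using s by (intro mult_left_mono Ev4) auto
      moreover have "3 / (4 * s) * s\<^sup>2 - 1 / (16 * s^3) * (4 * s^4) = s / 2"
        using s(1) by (simp add: power2_eq_square power3_eq_cube power4_eq_xxxx field_simps)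
      ultimately show ?thesis by linarith
    qed
    \<comment> \<open>The maximiser of \<open>t * s - 3 * t ^ 2\<close>, with value
      \<open>s ^ 2 / 12\<close>.\<close>
    define t where "t = s / 6"
    have "s\<^sup>2 / 12 \<le> 2 * t * avg ?X v - t\<^sup>2 * (1 + 2 * \<alpha> + 2 * \<beta>)"
    proof -
      have "t\<^sup>2 * (1 + 2 * \<alpha> + 2 * \<beta>) \<le> t\<^sup>2 * 3" using \<alpha>\<beta> by (intro mult_left_mono) auto
      moreover have "2 * t * (s / 2) \<le> 2 * t * avg ?X v" using s Ev by (intro mult_left_mono) (auto simp: t_def)
      ultimately show ?thesis by (simp add: t_def power2_eq_square)
    qed
    also have "\<dots> = avg ?X (\<lambda>x. 2 * t * v x - t\<^sup>2 * ((1 + 2 * (cmod (u x))\<^sup>2) + 2 * (cmod (z x))\<^sup>2))"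
      unfolding avg_diff avg_cmult avg_add Eu2 Ez2 avg_const[OF X] by simp
    also have "\<dots> \<le> avg ?X (\<lambda>x. (\<Sum>k<4. (cmod (z x + \<i> ^ k * u x) - 1)\<^sup>2) / 4)"
    proof (intro avg_mono)
      fix x
      define P where "P = 1 + 2 * ((cmod (z x))\<^sup>2 + (cmod (u x))\<^sup>2)"
      have P: "P > 0" unfolding P_def by (simp add: add_pos_nonneg)
      \<comment> \<open>This linearises the quotient, as \<open>v ^ 2 / P\<close> is at least
        \<open>2 * t * v - t ^ 2 * P\<close>.\<close>
      have "0 \<le> (v x - t * P)\<^sup>2 / P" using P by simp
      also have "\<dots> = (v x)\<^sup>2 / P - (2 * t * v x - t\<^sup>2 * P)"
        using P by (simp add: power2_eq_square field_simps)
      finally have "2 * t * v x - t\<^sup>2 * P \<le> (cmod (z x))\<^sup>2 * (cmod (u x))\<^sup>2 / P"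
        by (simp add: v_def power_mult_distrib mult.commute)
      also have "\<dots> \<le> (\<Sum>k<4. (cmod (z x + \<i> ^ k * u x) - 1)\<^sup>2) / 4"
        unfolding P_def by (rule quarter_turns_dist_one)
      finally show "2 * t * v x - t\<^sup>2 * ((1 + 2 * (cmod (u x))\<^sup>2) + 2 * (cmod (z x))\<^sup>2)
          \<le> (\<Sum>k<4. (cmod (z x + \<i> ^ k * u x) - 1)\<^sup>2) / 4"
        unfolding P_def by (simp add: algebra_simps)
    qed
    also have "\<dots> = avg ?X (\<lambda>x. (cmod (lin_form r UNIV x) - 1)\<^sup>2)"
    proof -
      have split: "lin_form r UNIV x = z x + u x" for x
        unfolding u_def z_def lin_form_def
        by (subst sum.union_disjoint[symmetric]) (auto simp: Un_commute Compl_partition)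
      have "z (quarter_turn S k x) = z x" "u (quarter_turn S k x) = \<i> ^ k * u x" for k x
        unfolding u_def z_def by (auto simp: lin_form_quarter_turn intro!: lin_form_quarter_turn_disjoint)
      then show ?thesis
        by (subst (2) avg_quarter_turns[OF m, of _ S]) (simp only: split)
    qed
    finally show ?thesis by (simp only: s(2) \<alpha>_def \<beta>_def)
  qed
qed

text \<open>Since the mean of the squared modulus is \<open>R\<close>, a lower bound on the mean
  square distance of the modulus from \<open>1\<close> is an upper bound on its mean. A balanced
  split supplies that distance: its imbalance is at most \<open>b\<close>, so the product of the two
  parts is at least \<open>(R ^ 2 - b ^ 2) / 4\<close>.\<close>

lemma avg_cmod_lin_form_le:
  fixes r :: "'n::finite \<Rightarrow> real"
  assumes m: "m > 0" "4 dvd m" and b: "\<And>j. (r j)\<^sup>2 \<le> b"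
    and bR: "b \<le> (\<Sum>j\<in>UNIV. (r j)\<^sup>2)" and R1: "(\<Sum>j\<in>UNIV. (r j)\<^sup>2) \<le> 1"
  shows "avg (root_grid m) (\<lambda>x. cmod (lin_form r UNIV x)) \<le> 1 - (1 - b) / 192"
proof -
  let ?X = "root_grid m :: ('n \<Rightarrow> complex) set" and ?y = "lin_form r UNIV"
  note X = finite_root_grid[OF m(1), where 'n = 'n] root_grid_nonempty
  define R where "R = (\<Sum>j\<in>UNIV. (r j)\<^sup>2)"
  have b0: "b \<ge> 0" using b order_trans zero_le_power2 by blast
  obtain S where S: "\<bar>R - 2 * (\<Sum>j\<in>S. (r j)\<^sup>2)\<bar> \<le> b"
    using balanced_split[of UNIV "\<lambda>j. (r j)\<^sup>2" b] b b0 unfolding R_def by auto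
  define \<alpha> where "\<alpha> = (\<Sum>j\<in>S. (r j)\<^sup>2)"
  have \<beta>: "(\<Sum>j\<in>-S. (r j)\<^sup>2) = R - \<alpha>"
    unfolding R_def \<alpha>_def using sum.subset_diff[of S UNIV "\<lambda>j. (r j)\<^sup>2"] by (simp add: Compl_eq_Diff_UNIV)
  have "(R - 2 * \<alpha>)\<^sup>2 \<le> b\<^sup>2"
    using S unfolding \<alpha>_def[symmetric] by (metis abs_ge_zero power2_abs power_mono)
  then have "R\<^sup>2 - b\<^sup>2 \<le> 4 * (\<alpha> * (R - \<alpha>))" by (simp add: power2_eq_square algebra_simps)
  moreover have "R * (R - b) \<le> R\<^sup>2 - b\<^sup>2"
    using mult_nonneg_nonneg[of b "R - b"] b0 bR unfolding R_def[symmetric]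
    by (simp add: power2_eq_square algebra_simps)
  ultimately have gap: "R * (R - b) / 48 \<le> \<alpha> * (R - \<alpha>) / 12" by simp
  have "\<alpha> * (R - \<alpha>) / 12 \<le> avg ?X (\<lambda>x. (cmod (?y x) - 1)\<^sup>2)"
    using avg_cmod_lin_form_dist_one[OF m R1, of S] unfolding \<beta> \<alpha>_def[symmetric] .
  also have "\<dots> = avg ?X (\<lambda>x. ((cmod (?y x))\<^sup>2 - 2 * cmod (?y x)) + 1)"
    by (intro avg_cong) (simp add: power2_eq_square algebra_simps)
  also have "\<dots> = R - 2 * avg ?X (\<lambda>x. cmod (?y x)) + 1"
    using lin_form_moments(1)[OF m, of "\<lambda>_. 1" UNIV r]
    unfolding avg_add avg_diff avg_cmult avg_const[OF X] by (simp add: R_def avg_const[OF X])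
  finally have "\<alpha> * (R - \<alpha>) / 12 \<le> R - 2 * avg ?X (\<lambda>x. cmod (?y x)) + 1" .
  then have "avg ?X (\<lambda>x. cmod (?y x)) \<le> 1 - ((1 - R) / 2 + R * (R - b) / 96)"
  proof -
    have "E \<le> 1 - ((1 - R) / 2 + K / 96)" if "K' / 12 \<le> R - 2 * E + 1" "K / 48 \<le> K' / 12" for E K K' :: real
      using that by (simp add: field_simps)
    from this[OF _ gap] show ?thesis
      using \<open>\<alpha> * (R - \<alpha>) / 12 \<le> R - 2 * avg ?X (\<lambda>x. cmod (?y x)) + 1\<close> by blast
  qed
  \<comment> \<open>A short row gains enough from \<open>(1 - R) / 2\<close> alone; otherwise
    \<open>R \<ge> 1 / 2\<close>, and \<open>1 - b\<close> is split as
    \<open>(1 - R) + (R - b)\<close>.\<close>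
  moreover have "(1 - b) / 192 \<le> (1 - R) / 2 + R * (R - b) / 96"
  proof (cases "R \<ge> 1 / 2")
    case True
    then have "1 / 2 * (R - b) \<le> R * (R - b)"
      using bR unfolding R_def[symmetric] by (intro mult_right_mono) auto
    then show ?thesis using R1 unfolding R_def[symmetric] by (simp add: field_simps)
  next
    case False
    moreover have "0 \<le> R * (R - b)" using b0 bR unfolding R_def[symmetric] by simp
    ultimately show ?thesis using b0 by (simp add: field_simps)
  qed
  ultimately show ?thesis by linarith
qed

theorem avg_deficit_ge:
  fixes A :: "real^'n^'n"
  assumes A: "onorm (\<lambda>x. A *v x) \<le> 1" and m: "m > 0" "4 dvd m"
  shows "real CARD('n) * (1 - h_inf A) / 96 \<le> avg (root_grid m) (deficit A)"
proof -
  let ?X = "root_grid m :: ('n \<Rightarrow> complex) set"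
  note X = finite_root_grid[OF m(1), where 'n = 'n] root_grid_nonempty
  define a where "a i = infnorm (row i A)" for i
  have "(1 - a i) / 192 \<le> 1 - avg ?X (\<lambda>x. cmod (row_form A x i))" for i
  proof -
    have norm: "(norm (row i A))\<^sup>2 = (\<Sum>j\<in>UNIV. (A $ i $ j)\<^sup>2)"
      unfolding power2_norm_eq_inner by (simp add: inner_vec_def row_def power2_eq_square)
    \<comment> \<open>As the image of a unit vector under the transposed contraction, a row has norm
      at most \<open>1\<close>.\<close>
    have "row i A = axis i 1 v* A"
      by (simp add: vec_eq_iff row_def vector_matrix_mult_def axis_def if_distrib if_distribR cong: if_cong)
    then have "norm (row i A) \<le> 1"
      using norm_vector_matrix_mult_le[OF A, of "axis i 1"] by (simp add: norm_axis_1)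
    then have n1: "(norm (row i A))\<^sup>2 \<le> 1" and a1: "a i \<le> 1"
      using infnorm_le_norm[of "row i A"] by (auto simp: a_def power_le_one)
    have a0: "a i \<ge> 0" by (simp add: a_def infnorm_pos_le)
    have "(A $ i $ j)\<^sup>2 \<le> (a i)\<^sup>2" for j
      using component_le_infnorm_cart[of "row i A" j] a0
      by (metis a_def abs_le_square_iff abs_of_nonneg row_def vec_lambda_beta)
    moreover have "(a i)\<^sup>2 \<le> (\<Sum>j\<in>UNIV. (A $ i $ j)\<^sup>2)"
      unfolding norm[symmetric] using a0 infnorm_le_norm[of "row i A"] by (intro power_mono) (auto simp: a_def)
    ultimately have "avg ?X (\<lambda>x. cmod (lin_form (\<lambda>j. A $ i $ j) UNIV x)) \<le> 1 - (1 - (a i)\<^sup>2) / 192"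
      using n1 unfolding norm by (intro avg_cmod_lin_form_le[OF m])
    \<comment> \<open>Passes from the squared maximum, natural for the split, to the maximum itself,
      which is what \<open>h_inf\<close> averages.\<close>
    moreover have "(a i)\<^sup>2 \<le> a i" using a0 a1 by (simp add: power2_eq_square mult_left_le)
    ultimately show ?thesis unfolding lin_form_def row_form_def by (simp add: field_simps)
  qed
  then have "2 * (\<Sum>i\<in>UNIV. (1 - a i) / 192) \<le> 2 * (\<Sum>i\<in>UNIV. 1 - avg ?X (\<lambda>x. cmod (row_form A x i)))"
    by (intro mult_left_mono sum_mono) auto
  also have "\<dots> = avg ?X (deficit A)"
    unfolding deficit_def[abs_def] avg_cmult avg_sum avg_diff avg_const[OF X] ..
  also have "2 * (\<Sum>i\<in>UNIV. (1 - a i) / 192) = real CARD('n) * (1 - h_inf A) / 96"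
    by (simp add: h_inf_def a_def sum_subtractf field_simps flip: sum_divide_distrib)
  finally show ?thesis .
qed

section \<open>Assembly of the bound and scaling\<close>

lemma perm_le_one:
  fixes A :: "real^'n^'n"
  assumes A: "onorm (\<lambda>x. A *v x) \<le> 1"
  shows "\<bar>perm A\<bar> \<le> 1"
proof -
  have "\<bar>perm A\<bar> \<le> avg (root_grid 2) (\<lambda>x. exp (\<Sum>i\<in>UNIV. cmod (row_form A x i) - 1))"
    by (rule perm_le_avg_exp) simp
  \<comment> \<open>Signs already suffice here: only nonnegativity of the deficit is used, not
    concentration.\<close>
  also have "\<dots> \<le> avg (root_grid 2 :: ('n \<Rightarrow> complex) set) (\<lambda>x. 1)"
  proof (intro avg_mono)
    fix x :: "'n \<Rightarrow> complex" assume x: "x \<in> root_grid 2"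
    have "0 \<le> deficit A x"
      by (rule deficit_nonneg[OF A cmod_root_grid[OF x]]) simp
    then show "exp (\<Sum>i\<in>UNIV. cmod (row_form A x i) - 1) \<le> 1"
      by (simp add: deficit_def sum_subtractf)
  qed
  also have "\<dots> = 1" by (intro avg_const finite_root_grid root_grid_nonempty) simp
  finally show ?thesis .
qed

lemma perm_bound_contraction:
  fixes A :: "real^'n^'n"
  assumes A: "onorm (\<lambda>x. A *v x) \<le> 1"
  shows "\<bar>perm A\<bar> \<le> (real CARD('n) + 6) * exp (- sqrt (real CARD('n) * (1 - h_inf A)) / 400)"
proof -
  define N where "N = real CARD('n) * (1 - h_inf A)"
  define m where "m = 8 * CARD('n)"
  have m: "m > 0" "4 dvd m" by (auto simp: m_def)
  define D where "D = avg (root_grid m) (deficit A)"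
  have D: "N / 96 \<le> D" unfolding N_def D_def by (rule avg_deficit_ge[OF A m])
  have P: "\<bar>perm A\<bar> \<le> exp (1 - sqrt (D - 53) / 10)"
    unfolding D_def by (rule perm_le_exp_avg_deficit[OF A m_def])
  have e: "exp 1 \<le> (3 :: real)" by (rule exp_le)
  have n: "real CARD('n) \<ge> 1" by (simp add: Suc_leI)
  show ?thesis
  proof (cases "N \<le> 160000")
    \<comment> \<open>The threshold is \<open>400 ^ 2\<close>: below it the exponent is at least
      \<open>- 1\<close>, and \<open>7 / exp 1\<close> exceeds the trivial bound
      \<open>1\<close>.\<close>
    case True
    then have "sqrt N \<le> 400" using real_sqrt_le_mono[of N "400\<^sup>2"] by simp
    then have "exp (- 1) \<le> exp (- sqrt N / 400)" by simp
    moreover have "1 \<le> 3 * exp (- 1 :: real)" using e by (simp add: exp_minus field_simps)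
    ultimately have "1 \<le> 7 * exp (- sqrt N / 400)" by linarith
    also have "\<dots> \<le> (real CARD('n) + 6) * exp (- sqrt N / 400)"
      using n by (intro mult_right_mono) auto
    finally show ?thesis using perm_le_one[OF A] unfolding N_def by linarith
  next
    case False
    \<comment> \<open>Above the threshold, passing from \<open>N / 96\<close> to
      \<open>N / 1600\<close> more than pays for \<open>53\<close>; the roots then combine as
      \<open>40 * 10 = 400\<close>.\<close>
    then have "N / 1600 \<le> D - 53" using D by simp
    then have "sqrt N / 40 \<le> sqrt (D - 53)"
      using real_sqrt_le_mono[of "N / 1600" "D - 53"] by (simp add: real_sqrt_divide real_sqrt_eq_iff)
    then have "exp (1 - sqrt (D - 53) / 10) \<le> exp 1 * exp (- sqrt N / 400)"
      by (simp flip: exp_add)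
    also have "\<dots> \<le> (real CARD('n) + 6) * exp (- sqrt N / 400)"
      using e n by (intro mult_right_mono) auto
    finally show ?thesis using P unfolding N_def by linarith
  qed
qed

lemma perm_scaleR:
  fixes A :: "real^'n^'n"
  shows "perm (c *\<^sub>R A) = c ^ CARD('n) * perm A"
  by (simp add: perm_def prod.distrib sum_distrib_left)

lemma h_inf_scaleR:
  fixes A :: "real^'n^'n"
  shows "h_inf (c *\<^sub>R A) = \<bar>c\<bar> * h_inf A"
proof -
  have "row i (c *\<^sub>R A) = c *\<^sub>R row i A" for i by (simp add: vec_eq_iff row_def)
  then show ?thesis by (simp add: h_inf_def infnorm_mul sum_distrib_left)
qed

theorem theorem3:
  fixes A :: "real^'n^'n" and T :: real
  assumes "T > 0"
    and "onorm (\<lambda>x. A *v x) \<le> T"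
  shows "\<bar>perm A\<bar> \<le> T ^ CARD('n) * (real CARD('n) + 6) *
    exp (- sqrt (real CARD('n) * (1 - h_inf A / T)) / 400)"
proof -
  let ?B = "(1 / T) *\<^sub>R A"
  have "onorm (\<lambda>x. ?B *v x) = onorm (\<lambda>x. (1 / T) *\<^sub>R (A *v x))"
    by (simp add: scaleR_matrix_vector_assoc)
  also have "\<dots> = \<bar>1 / T\<bar> * onorm (\<lambda>x. A *v x)"
    by (intro onorm_scaleR linear_linear[THEN iffD2] matrix_vector_mul_linear)
  also have "\<dots> \<le> 1" using assms by simp
  finally have "\<bar>perm ?B\<bar> \<le> (real CARD('n) + 6) * exp (- sqrt (real CARD('n) * (1 - h_inf ?B)) / 400)"
    by (rule perm_bound_contraction)
  then have "T ^ CARD('n) * \<bar>perm ?B\<bar> \<le> T ^ CARD('n) *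
      ((real CARD('n) + 6) * exp (- sqrt (real CARD('n) * (1 - h_inf ?B)) / 400))"
    using assms(1) by (intro mult_left_mono) auto
  moreover have "h_inf ?B = h_inf A / T" using assms(1) by (simp add: h_inf_scaleR)
  moreover have "\<bar>perm A\<bar> = T ^ CARD('n) * \<bar>perm ?B\<bar>"
    using assms(1) perm_scaleR[of T ?B] by (simp add: abs_mult)
  ultimately show ?thesis by (simp only: mult.assoc)
qed

end
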